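(* Let $\phi$ be a symmetric gauge on $\mathbb{R}^n$ and let $I\subseteq\{1,\dots,n\}$. Given $\bar X\in\mathbb{S}^n$, $$g_{I,\phi}(\bar X)=\min_{\substack{S\in\mathbb{S}^{|I|}_+\\ \phi_I(\lambda(S))\le 1}}\langle S,\bar X_I\rangle=-\phi_I^\circ\big(\lambda_-(\bar X_I)\big).$$ Thus $g_{I,\phi}(\bar X)=0$ if and only if $\bar X\in\iota_I(\mathbb{S}^{|I|}_+)^*$. If $g_{I,\phi}(\bar X)<0$, $\bar X_I=Q\operatorname{diag}(\lambda(\bar X_I))Q^\top$ is an eigendecomposition with $Q$ orthogonal, and $$z^\star\in\operatorname{argmax}\{\lambda_-(\bar X_I)^\top z:\ z\in\mathbb{R}^{|I|}_+,\ \phi_I(z)\le 1,\ \operatorname{supp}(z)\subseteq\operatorname{supp}(\lambda_-(\bar X_I))\},$$ then an optimal separator for $g_{I,\phi}(\bar X)$ (a minimizer of the problem defining it) is $$S_I^\star=E_I\,Q\operatorname{diag}(z^\star)Q^\top E_I^\top\in\mathcal{B}_{I,\phi}\subseteq\iota_I(\mathbb{S}^{|I|}_+).$$ Moreover, $\langle S_I^\star,X\rangle\ge 0$ for all $X\in\iota_I(\mathbb{S}^{|I|}_+)^*$, and in particular for every $X\in\mathbb{S}^n_+$.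
   Context: $\mathbb{S}^m$ is the space of real symmetric $m\times m$ matrices with the Frobenius inner product $\langle A,B\rangle=\operatorname{tr}(A^\top B)$; $\mathbb{S}^m_+$ is the cone of positive semidefinite matrices. For $X\in\mathbb{S}^m$, $\lambda(X)\in\mathbb{R}^m$ is the vector of eigenvalues in nondecreasing order, repeated with multiplicity, and $\lambda_-(X):=(\max\{-\lambda_i(X),0\})_{i}$. The support of a vector is the set of indices of its nonzero components; the support of a symmetric matrix is the set of indices of its rows having a nonzero component. A symmetric gauge on $\mathbb{R}^n$ is a norm $\phi$ with $\phi(z)=\phi(|z|)$ (componentwise absolute value) and $\phi(Pz)=\phi(z)$ for every permutation matrix $P$ and all $z$. The dual of a norm $\psi$ is $\psi^\circ(y)=\max\{|y^\top z|:\ \psi(z)\le 1\}$. $\mathcal{B}_\phi:=\{S\in\mathbb{S}^n:\ \phi(\lambda(S))\le 1\}$. For $I\subseteq\{1,\dots,n\}$, $E_I\in\{0,1\}^{n\times|I|}$ is the principal block selector: its columns are the canonical vectors $e_i$, $i\in I$, so that $X_I:=E_I^\top XE_I\in\mathbb{S}^{|I|}$ is the principal submatrix of $X\in\mathbb{S}^n$ indexed by $I$. The lifting map is $\iota_I(T):=E_ITE_I^\top\in\mathbb{S}^n$ for $T\in\mathbb{S}^{|I|}$. The dual cone of a cone $\mathcal{K}\subseteq\mathbb{S}^n$ is $\mathcal{K}^*=\{X\in\mathbb{S}^n:\langle S,X\rangle\ge 0\ \forall S\in\mathcal{K}\}$; in particular $\iota_I(\mathbb{S}^{|I|}_+)^*=\{X\in\mathbb{S}^n:\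 X_I\in\mathbb{S}^{|I|}_+\}$. The gauge $\phi_I$ on $\mathbb{R}^{|I|}$ is obtained by zero-padding, $\phi_I(u):=\phi((u,0_{[n]\setminus I}))$, and is a symmetric gauge. Set $$\mathcal{B}_{I,\phi}:=\{E_IS_IE_I^\top:\ S_I\in\mathbb{S}^{|I|}_+,\ \phi_I(\lambda(S_I))\le 1\},\qquad g_{I,\phi}(\bar X):=\min\{\langle S,\bar X\rangle:\ S\in\mathbb{S}^n_+\cap\mathcal{B}_\phi,\ \operatorname{supp}(S)\subseteq I\}.$$ *)

theory Defs
  imports "Jordan_Normal_Form.Char_Poly" "HOL-Combinatorics.Permutations"
begin

text \<open>
  Vectors and matrices are those of \<^theory>\<open>Jordan_Normal_Form.Matrix\<close>, whose entries are indexed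
  from 0, so the index set $\{1,\dots,n\}$ becomes \<open>{..<n}\<close>. Functions on $\mathbb{R}^m$ are
  functions on \<^typ>\<open>real vec\<close> of which only the values on \<open>carrier_vec m\<close> matter.
\<close>

text \<open>
  The minimum and maximum of \<open>f\<close> over \<open>A\<close>; the values are meaningful only if they are attained.
\<close>

definition minimum :: "('a \<Rightarrow> real) \<Rightarrow> 'a set \<Rightarrow> real" where
  "minimum f A = (LEAST v. v \<in> f ` A)"

definition maximum :: "('a \<Rightarrow> real) \<Rightarrow> 'a set \<Rightarrow> real" where
  "maximum f A = (GREATEST v. v \<in> f ` A)"

definition sym_mats :: "nat \<Rightarrow> real mat set" where
  "sym_mats m = {A \<in> carrier_mat m m. transpose_mat A = A}"

definition psd_mats :: "nat \<Rightarrow> real mat set" where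
  "psd_mats m = {A \<in> sym_mats m. \<forall>v \<in> carrier_vec m. 0 \<le> v \<bullet> (A *\<^sub>v v)}"

definition trace :: "real mat \<Rightarrow> real" where
  "trace A = (\<Sum>i<dim_row A. A $$ (i, i))"

definition frob_inner :: "real mat \<Rightarrow> real mat \<Rightarrow> real" where
  "frob_inner A B = trace (transpose_mat A * B)"

text \<open>
  The real roots of the characteristic polynomial, with multiplicity. For \<open>X \<in> sym_mats m\<close> these
  are all its roots, and algebraic and geometric multiplicities agree, so the result lies in
  \<open>carrier_vec m\<close>.
\<close>

definition eigvals :: "real mat \<Rightarrow> real vec" where
  "eigvals X = vec_of_list (sorted_list_of_multiset (proots (char_poly X)))"

definition eigvals_neg :: "real mat \<Rightarrow> real vec" where
  "eigvals_neg X = map_vec (\<lambda>x. max (- x) 0) (eigvals X)"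

definition vec_supp :: "real vec \<Rightarrow> nat set" where
  "vec_supp v = {i. i < dim_vec v \<and> v $ i \<noteq> 0}"

definition mat_supp :: "real mat \<Rightarrow> nat set" where
  "mat_supp A = {i. i < dim_row A \<and> (\<exists>j<dim_col A. A $$ (i, j) \<noteq> 0)}"

definition orthogonal_mats :: "nat \<Rightarrow> real mat set" where
  "orthogonal_mats m = {Q \<in> carrier_mat m m. transpose_mat Q * Q = 1\<^sub>m m \<and> Q * transpose_mat Q = 1\<^sub>m m}"

definition diag_of_vec :: "real vec \<Rightarrow> real mat" where
  "diag_of_vec v = mat_diag (dim_vec v) (\<lambda>i. v $ i)"

definition permutation_mats :: "nat \<Rightarrow> real mat set" where
  "permutation_mats m =
    {mat m m (\<lambda>(i, j). if j = p i then 1 else 0) | p. p permutes {..<m}}"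

definition norm_on :: "nat \<Rightarrow> (real vec \<Rightarrow> real) \<Rightarrow> bool" where
  "norm_on m \<psi> \<longleftrightarrow>
    (\<forall>z \<in> carrier_vec m. 0 \<le> \<psi> z \<and> (\<psi> z = 0 \<longleftrightarrow> z = 0\<^sub>v m)) \<and>
    (\<forall>z \<in> carrier_vec m. \<forall>c. \<psi> (c \<cdot>\<^sub>v z) = \<bar>c\<bar> * \<psi> z) \<and>
    (\<forall>y \<in> carrier_vec m. \<forall>z \<in> carrier_vec m. \<psi> (y + z) \<le> \<psi> y + \<psi> z)"

definition symmetric_gauge :: "nat \<Rightarrow> (real vec \<Rightarrow> real) \<Rightarrow> bool" where
  "symmetric_gauge m \<phi> \<longleftrightarrow> norm_on m \<phi> \<and>
    (\<forall>z \<in> carrier_vec m. \<phi> (map_vec abs z) = \<phi> z) \<and>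
    (\<forall>z \<in> carrier_vec m. \<forall>P \<in> permutation_mats m. \<phi> (P *\<^sub>v z) = \<phi> z)"

definition dual_norm :: "nat \<Rightarrow> (real vec \<Rightarrow> real) \<Rightarrow> real vec \<Rightarrow> real" where
  "dual_norm m \<psi> y = maximum (\<lambda>z. \<bar>y \<bullet> z\<bar>) {z \<in> carrier_vec m. \<psi> z \<le> 1}"

definition spectral_ball :: "nat \<Rightarrow> (real vec \<Rightarrow> real) \<Rightarrow> real mat set" where
  "spectral_ball m \<phi> = {S \<in> sym_mats m. \<phi> (eigvals S) \<le> 1}"

text \<open>The columns of $E_I$ are the canonical vectors $e_i$, \<open>i \<in> I\<close>, in increasing order of \<open>i\<close>.\<close>

definition selector :: "nat \<Rightarrow> nat set \<Rightarrow> real mat" where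
  "selector n I = mat n (card I) (\<lambda>(i, k). if i = sorted_list_of_set I ! k then 1 else 0)"

definition principal_block :: "nat \<Rightarrow> nat set \<Rightarrow> real mat \<Rightarrow> real mat" where
  "principal_block n I X = transpose_mat (selector n I) * X * selector n I"

definition lift_block :: "nat \<Rightarrow> nat set \<Rightarrow> real mat \<Rightarrow> real mat" where
  "lift_block n I T = selector n I * T * transpose_mat (selector n I)"

definition dual_cone :: "nat \<Rightarrow> real mat set \<Rightarrow> real mat set" where
  "dual_cone n K = {X \<in> sym_mats n. \<forall>S \<in> K. 0 \<le> frob_inner S X}"

text \<open>The zero-padding of \<open>u\<close> to $\mathbb{R}^n$, with the entries of \<open>u\<close> at the positions in \<open>I\<close>, is $E_I u$.\<close>

definition padded_gauge :: "nat \<Rightarrow> nat set \<Rightarrow> (real vec \<Rightarrow> real) \<Rightarrow> real vec \<Rightarrow> real" where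
  "padded_gauge n I \<phi> u = \<phi> (selector n I *\<^sub>v u)"

definition lifted_ball :: "nat \<Rightarrow> nat set \<Rightarrow> (real vec \<Rightarrow> real) \<Rightarrow> real mat set" where
  "lifted_ball n I \<phi> =
    lift_block n I ` {S \<in> psd_mats (card I). padded_gauge n I \<phi> (eigvals S) \<le> 1}"

definition sep_feasible :: "nat \<Rightarrow> nat set \<Rightarrow> (real vec \<Rightarrow> real) \<Rightarrow> real mat set" where
  "sep_feasible n I \<phi> = {S \<in> psd_mats n \<inter> spectral_ball n \<phi>. mat_supp S \<subseteq> I}"

definition sep_value :: "nat \<Rightarrow> nat set \<Rightarrow> (real vec \<Rightarrow> real) \<Rightarrow> real mat \<Rightarrow> real" where
  "sep_value n I \<phi> X = minimum (\<lambda>S. frob_inner S X) (sep_feasible n I \<phi>)"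

end

theory Submission
  imports Defs "Jordan_Normal_Form.Schur_Decomposition"
begin

text \<open>
  Restricting the support of \<open>S\<close> to \<open>I\<close> turns the problem on \<open>n \<times> n\<close> matrices into one on
  \<open>|I| \<times> |I|\<close> matrices: a symmetric \<open>S\<close> supported on \<open>I\<close> is the lift \<open>E T E\<^sup>T\<close> of its principal block
  \<open>T\<close>, lifting only adds zero eigenvalues (so \<open>\<phi>\<close> of the spectrum of \<open>S\<close> is the padded gauge \<open>\<psi>\<close> of the
  spectrum of \<open>T\<close>), and \<open>\<langle>E T E\<^sup>T, X\<rangle> = \<langle>T, E\<^sup>T X E\<rangle>\<close>. Hence \<open>sep_feasible\<close> is the lifted ball
  (\<open>sep_feasible_eq_lifted_ball\<close>), and both minimisation problems are the minimisation of \<open>\<langle>T, A\<rangle>\<close>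
  over the psd matrices \<open>T\<close> with \<open>\<psi> (\<lambda>(T)) \<le> 1\<close>, where \<open>A\<close> is the principal block of \<open>X\<close>.

  The lower bound (\<open>frob_inner_psd_lower_bound\<close>) is a trace inequality. In eigenbases of \<open>T\<close> and \<open>A\<close>,
  \<open>\<langle>T, A\<rangle> = \<Sum>\<^sub>i\<^sub>j V\<^sub>j\<^sub>i\<^sup>2 s\<^sub>j a\<^sub>i\<close>, where \<open>s\<close> and \<open>a\<close> are the spectra and \<open>V\<close> is orthogonal, so the
  matrix of squares is doubly stochastic. Since \<open>s \<ge> 0\<close>, replacing \<open>a\<close> by \<open>- \<lambda>\<^sub>-(A)\<close> only decreases
  the sum, and a doubly stochastic average of products of two nonnegative sequences is at most the sum of
  the products of the sequences sorted in the same order (\<open>doubly_stochastic_rearrangement\<close>).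
  Permutation invariance of \<open>\<psi>\<close> and the definition of the dual norm then give
  \<open>\<langle>T, A\<rangle> \<ge> - \<psi>\<^sup>\<circ>(\<lambda>\<^sub>-(A))\<close>.

  The bound is attained: a maximiser in the dual norm exists because the unit ball of \<open>\<psi>\<close> is compact,
  and because \<open>\<psi>\<close> is invariant under sign changes and cannot increase when coordinates are deleted, it may
  be taken nonnegative and supported where \<open>\<lambda>\<^sub>-(A)\<close> is (\<open>dual_norm_attained_nonneg\<close>). For such a \<open>z\<close> the
  matrix \<open>Q diag(z) Q\<^sup>T\<close>, built from an eigenbasis \<open>Q\<close> of \<open>A\<close>, only sees the negative eigenvalues of
  \<open>A\<close>, so its inner product with \<open>A\<close> is \<open>- \<lambda>\<^sub>-(A)\<^sup>T z = - \<psi>\<^sup>\<circ>(\<lambda>\<^sub>-(A))\<close>. The remaining claims follow: the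
  value is \<open>0\<close> iff \<open>\<lambda>\<^sub>-(A) = 0\<close>, which says that \<open>A\<close> is psd, and the inner product of two psd
  matrices is nonnegative.
\<close>

section \<open>Symmetric gauges and their dual norms\<close>

locale sym_gauge =
  fixes m :: nat and \<psi> :: "real vec \<Rightarrow> real"
  assumes gauge: "symmetric_gauge m \<psi>"
begin

lemma gauge_zero_iff: "z \<in> carrier_vec m \<Longrightarrow> \<psi> z = 0 \<longleftrightarrow> z = 0\<^sub>v m"
  and gauge_nonneg: "z \<in> carrier_vec m \<Longrightarrow> 0 \<le> \<psi> z"
  and gauge_smult: "z \<in> carrier_vec m \<Longrightarrow> \<psi> (c \<cdot>\<^sub>v z) = \<bar>c\<bar> * \<psi> z"
  and gauge_triangle: "y \<in> carrier_vec m \<Longrightarrow> z \<in> carrier_vec m \<Longrightarrow> \<psi> (y + z) \<le> \<psi> y + \<psi> z"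
  using gauge by (auto simp: symmetric_gauge_def norm_on_def)

lemma gauge_cong_abs:
  assumes "y \<in> carrier_vec m" "z \<in> carrier_vec m" "\<And>i. i < m \<Longrightarrow> \<bar>y $ i\<bar> = \<bar>z $ i\<bar>"
  shows "\<psi> y = \<psi> z"
proof -
  have "map_vec abs y = map_vec abs z"
    using assms by (intro eq_vecI) auto
  moreover have "\<psi> (map_vec abs y) = \<psi> y" "\<psi> (map_vec abs z) = \<psi> z"
    using assms(1,2) gauge by (simp_all add: symmetric_gauge_def)
  ultimately show ?thesis by simp
qed

lemma gauge_permute:
  assumes z: "z \<in> carrier_vec m" and p: "p permutes {..<m}"
  shows "\<psi> (vec m (\<lambda>i. z $ p i)) = \<psi> z"
proof -
  let ?P = "mat m m (\<lambda>(i, j). if j = p i then 1 else 0) :: real mat"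
  have "p i < m" if "i < m" for i
    using permutes_in_image[OF p, of i] that by simp
  then have "?P *\<^sub>v z = vec m (\<lambda>i. z $ p i)"
    using z by (intro eq_vecI) (auto simp: scalar_prod_def if_distrib[of "\<lambda>x. x * _"] cong: if_cong)
  moreover have "?P \<in> permutation_mats m"
    using p by (auto simp: permutation_mats_def)
  then have "\<psi> (?P *\<^sub>v z) = \<psi> z"
    using gauge z unfolding symmetric_gauge_def by blast
  ultimately show ?thesis by simp
qed

text \<open>
  This is how permutation invariance is used below: spectra are only determined up to order.
\<close>

lemma gauge_cong_mset:
  assumes y: "y \<in> carrier_vec m" and z: "z \<in> carrier_vec m"
    and eq: "mset (list_of_vec y) = mset (list_of_vec z)"
  shows "\<psi> y = \<psi> z"
proof -
  obtain p where p: "p permutes {..<length (list_of_vec z)}"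
    and y_eq: "permute_list p (list_of_vec z) = list_of_vec y"
    using mset_eq_permutation[OF eq] by blast
  have p': "p permutes {..<m}"
    using p z by simp
  have "y = vec m (\<lambda>i. z $ p i)"
  proof (rule eq_vecI)
    fix i assume "i < dim_vec (vec m (\<lambda>i. z $ p i))"
    then have i: "i < m" by simp
    have pi: "p i < m"
      using permutes_in_image[OF p', of i] i by simp
    have "y $ i = list_of_vec y ! i"
      using i y by (simp add: list_of_vec_index)
    also have "\<dots> = list_of_vec z ! p i"
      using i z p by (simp flip: y_eq add: permute_list_nth)
    also have "\<dots> = z $ p i"
      using pi z by (simp add: list_of_vec_index)
    finally show "y $ i = vec m (\<lambda>i. z $ p i) $ i"
      using i by simp
  qed (use y in simp)
  then show ?thesis
    using gauge_permute[OF z p'] by simp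
qed

text \<open>
  The restriction is the average of \<open>z\<close> and the vector with the signs outside \<open>J\<close> flipped, which has
  the same gauge.
\<close>

lemma gauge_restrict_le:
  assumes z: "z \<in> carrier_vec m"
  shows "\<psi> (vec m (\<lambda>i. if i \<in> J then z $ i else 0)) \<le> \<psi> z"
proof -
  let ?r = "vec m (\<lambda>i. if i \<in> J then z $ i else 0)"
  let ?f = "vec m (\<lambda>i. if i \<in> J then z $ i else - z $ i)"
  have "?r = (1/2) \<cdot>\<^sub>v (z + ?f)"
    using z by (intro eq_vecI) auto
  then have "\<psi> ?r = 1/2 * \<psi> (z + ?f)"
    using z by (simp add: gauge_smult)
  also have "\<dots> \<le> 1/2 * (\<psi> z + \<psi> ?f)"
    using gauge_triangle[OF z, of ?f] by simp
  also have "\<psi> ?f = \<psi> z"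
    using z by (intro gauge_cong_abs) auto
  finally show ?thesis by simp
qed

lemma gauge_unit_pos: "i < m \<Longrightarrow> 0 < \<psi> (unit_vec m i)"
  using gauge_nonneg[of "unit_vec m i"] gauge_zero_iff[of "unit_vec m i"]
  by (metis index_unit_vec(1) index_zero_vec(1) less_eq_real_def unit_vec_carrier zero_neq_one)

text \<open>
  Bounds the coordinates on the unit ball: deleting all coordinates but one does not increase the gauge.
\<close>

lemma coord_le_gauge:
  assumes z: "z \<in> carrier_vec m" and i: "i < m"
  shows "\<bar>z $ i\<bar> * \<psi> (unit_vec m i) \<le> \<psi> z"
proof -
  have "z $ i \<cdot>\<^sub>v unit_vec m i = vec m (\<lambda>j. if j \<in> {i} then z $ j else 0)"
    using z i by (intro eq_vecI) auto
  then show ?thesis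
    using gauge_restrict_le[OF z, of "{i}"] gauge_smult[of "unit_vec m i" "z $ i"] by simp
qed

text \<open>
  Applied to a difference, this says that a gauge is Lipschitz in the coordinates.
\<close>

lemma gauge_le_sum:
  assumes z: "z \<in> carrier_vec m"
  shows "\<psi> z \<le> (\<Sum>i<m. \<bar>z $ i\<bar> * \<psi> (unit_vec m i))"
proof -
  let ?t = "\<lambda>j. vec m (\<lambda>i. if i < j then z $ i else 0)"
  have trunc: "\<psi> (?t j) \<le> (\<Sum>i<j. \<bar>z $ i\<bar> * \<psi> (unit_vec m i))" if "j \<le> m" for j
    using that
  proof (induction j)
    case 0
    have "?t 0 = 0\<^sub>v m" by (intro eq_vecI) simp_all
    then show ?case using gauge_zero_iff[of "0\<^sub>v m"] by simp
  next
    case (Suc j)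
    have "?t (Suc j) = ?t j + z $ j \<cdot>\<^sub>v unit_vec m j"
      using Suc.prems by (intro eq_vecI) (auto simp: less_Suc_eq)
    then have "\<psi> (?t (Suc j)) \<le> \<psi> (?t j) + \<bar>z $ j\<bar> * \<psi> (unit_vec m j)"
      using gauge_triangle[of "?t j" "z $ j \<cdot>\<^sub>v unit_vec m j"] by (simp add: gauge_smult)
    then show ?case using Suc by simp
  qed
  have "?t m = z" using z by (intro eq_vecI) auto
  then show ?thesis using trunc[of m] by simp
qed

end

text \<open>
  The dimension of \<^typ>\<open>real vec\<close> is not fixed by the type, so compactness is expressed through
  coordinates: one coordinate is treated at a time, passing to a further subsequence.
\<close>

lemma bounded_coords_convergent_subseq:
  fixes f :: "nat \<Rightarrow> nat \<Rightarrow> real"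
  assumes "\<And>i n. i < k \<Longrightarrow> \<bar>f n i\<bar> \<le> C i"
  shows "\<exists>r l. strict_mono (r :: nat \<Rightarrow> nat) \<and> (\<forall>i<k. (\<lambda>n. f (r n) i) \<longlonglongrightarrow> l i)"
  using assms
proof (induction k)
  case 0
  have "strict_mono (\<lambda>n::nat. n)" by (simp add: strict_mono_def)
  then show ?case by blast
next
  case (Suc k)
  have "\<exists>r l. strict_mono (r :: nat \<Rightarrow> nat) \<and> (\<forall>i<k. (\<lambda>n. f (r n) i) \<longlonglongrightarrow> l i)"
    using Suc.prems by (intro Suc.IH) simp
  then obtain r :: "nat \<Rightarrow> nat" and l where r: "strict_mono r"
    and lim: "\<And>i. i < k \<Longrightarrow> (\<lambda>n. f (r n) i) \<longlonglongrightarrow> l i"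
    by blast
  obtain s :: "nat \<Rightarrow> nat" where s: "strict_mono s" "monoseq (\<lambda>n. f (r (s n)) k)"
    using seq_monosub[of "\<lambda>n. f (r n) k"] by (auto simp: o_def)
  have "Bseq (\<lambda>n. f (r (s n)) k)"
    using Suc.prems[of k] by (intro BseqI'[of _ "C k"]) simp
  then obtain x where x: "(\<lambda>n. f (r (s n)) k) \<longlonglongrightarrow> x"
    using s(2) Bseq_monoseq_convergent convergent_def by blast
  have "(\<lambda>n. f ((r \<circ> s) n) i) \<longlonglongrightarrow> (l(k := x)) i" if "i < Suc k" for i
    using that x LIMSEQ_subseq_LIMSEQ[OF lim[of i] s(1)] by (auto simp: o_def less_Suc_eq)
  then show ?case
    using strict_mono_o[OF r s(1)] by blast
qed

context sym_gauge
begin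

lemma gauge_le_limit:
  assumes z: "\<And>n. z n \<in> carrier_vec m" and le: "\<And>n. \<psi> (z n) \<le> c"
    and y: "y \<in> carrier_vec m" and lim: "\<And>i. i < m \<Longrightarrow> (\<lambda>n. z n $ i) \<longlonglongrightarrow> y $ i"
  shows "\<psi> y \<le> c"
proof -
  let ?e = "\<lambda>n. \<Sum>i<m. \<bar>y $ i - z n $ i\<bar> * \<psi> (unit_vec m i)"
  have "?e \<longlonglongrightarrow> (\<Sum>i<m. \<bar>y $ i - y $ i\<bar> * \<psi> (unit_vec m i))"
    by (intro tendsto_intros lim) auto
  then have "(\<lambda>n. c + ?e n) \<longlonglongrightarrow> c + 0"
    by (intro tendsto_intros) auto
  moreover have "\<psi> y \<le> c + ?e n" for n
  proof -
    have "\<psi> (z n + (y - z n)) \<le> \<psi> (z n) + \<psi> (y - z n)"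
      using z y by (intro gauge_triangle) auto
    moreover have "z n + (y - z n) = y"
      using z[of n] y by (intro eq_vecI) auto
    moreover have "\<psi> (y - z n) \<le> ?e n"
      using gauge_le_sum[of "y - z n"] z[of n] y by simp
    ultimately show ?thesis using le[of n] by simp
  qed
  ultimately show ?thesis
    by (auto intro: LIMSEQ_le_const)
qed

lemma linear_functional_attains_max:
  assumes b: "b \<in> carrier_vec m"
  obtains z where "z \<in> carrier_vec m" "\<psi> z \<le> 1"
    "\<And>y. y \<in> carrier_vec m \<Longrightarrow> \<psi> y \<le> 1 \<Longrightarrow> b \<bullet> y \<le> b \<bullet> z"
proof -
  let ?K = "{z \<in> carrier_vec m. \<psi> z \<le> 1}"
  have coord: "\<bar>z $ i\<bar> \<le> 1 / \<psi> (unit_vec m i)" if "z \<in> ?K" "i < m" for z i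
    using coord_le_gauge[of z i] gauge_unit_pos[of i] that by (auto simp: field_simps)
  have prod: "b \<bullet> z = (\<Sum>i<m. b $ i * z $ i)" if "z \<in> carrier_vec m" for z
    using that by (simp add: scalar_prod_def atLeast0LessThan)
  have "b \<bullet> z \<le> (\<Sum>i<m. \<bar>b $ i\<bar> * (1 / \<psi> (unit_vec m i)))" if "z \<in> ?K" for z
  proof -
    have "b \<bullet> z \<le> (\<Sum>i<m. \<bar>b $ i\<bar> * \<bar>z $ i\<bar>)"
      using that by (auto simp: prod simp flip: abs_mult intro!: sum_mono)
    also have "\<dots> \<le> (\<Sum>i<m. \<bar>b $ i\<bar> * (1 / \<psi> (unit_vec m i)))"
      using coord[OF that] by (intro sum_mono mult_left_mono) auto
    finally show ?thesis .
  qed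
  then have bdd: "bdd_above ((\<bullet>) b ` ?K)"
    by (intro bdd_aboveI2)
  have "0\<^sub>v m \<in> ?K" using gauge_zero_iff[of "0\<^sub>v m"] by simp
  then have ne: "(\<bullet>) b ` ?K \<noteq> {}" by blast
  let ?s = "Sup ((\<bullet>) b ` ?K)"
  have "\<exists>z. z \<in> ?K \<and> ?s - 1 / real (Suc n) < b \<bullet> z" for n
    using less_cSup_iff[OF ne bdd, of "?s - 1 / real (Suc n)"] by auto
  then have "\<exists>f. \<forall>n. f n \<in> ?K \<and> ?s - 1 / real (Suc n) < b \<bullet> f n"
    by (intro choice allI)
  then obtain f where f: "\<And>n. f n \<in> ?K" "\<And>n. ?s - 1 / real (Suc n) < b \<bullet> f n"
    by auto
  obtain r :: "nat \<Rightarrow> nat" and l where r: "strict_mono r"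
    and lim: "\<And>i. i < m \<Longrightarrow> (\<lambda>n. f (r n) $ i) \<longlonglongrightarrow> l i"
    using bounded_coords_convergent_subseq[of m "\<lambda>n i. f n $ i", OF coord[OF f(1)]] by blast
  define z where "z = vec m l"
  have z: "z \<in> carrier_vec m" by (simp add: z_def)
  have "\<psi> z \<le> 1"
    by (rule gauge_le_limit[of "\<lambda>n. f (r n)"]) (use f(1) lim in \<open>auto simp: z_def\<close>)
  moreover have "?s \<le> b \<bullet> z"
  proof (rule LIMSEQ_le)
    show "(\<lambda>n. ?s - 1 / real (Suc n)) \<longlonglongrightarrow> ?s"
      using tendsto_diff[OF tendsto_const LIMSEQ_inverse_real_of_nat, of ?s] by (simp add: field_simps)
    have "(\<lambda>n. \<Sum>i<m. b $ i * f (r n) $ i) \<longlonglongrightarrow> (\<Sum>i<m. b $ i * l i)"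
      by (intro tendsto_intros lim) auto
    then show "(\<lambda>n. b \<bullet> f (r n)) \<longlonglongrightarrow> b \<bullet> z"
      using f(1) by (auto simp: prod z_def)
    have "?s - 1 / real (Suc n) \<le> b \<bullet> f (r n)" for n
    proof -
      have "1 / real (Suc (r n)) \<le> 1 / real (Suc n)"
        using seq_suble[OF r, of n] by (simp add: field_simps)
      then show ?thesis using f(2)[of "r n"] by linarith
    qed
    then show "\<exists>N. \<forall>n\<ge>N. ?s - 1 / real (Suc n) \<le> b \<bullet> f (r n)" by blast
  qed
  then have "b \<bullet> y \<le> b \<bullet> z" if "y \<in> carrier_vec m" "\<psi> y \<le> 1" for y
    using cSup_upper[OF _ bdd, of "b \<bullet> y"] that by auto
  ultimately show ?thesis using z that by blast
qed

text \<open>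
  The ball is symmetric under \<open>z \<mapsto> - z\<close>, so a maximiser of \<open>b \<bullet> z\<close> also maximises the absolute value.
\<close>

lemma dual_norm_attained:
  assumes b: "b \<in> carrier_vec m"
  obtains z where "z \<in> carrier_vec m" "\<psi> z \<le> 1" "dual_norm m \<psi> b = b \<bullet> z"
    "\<And>y. y \<in> carrier_vec m \<Longrightarrow> \<psi> y \<le> 1 \<Longrightarrow> \<bar>b \<bullet> y\<bar> \<le> b \<bullet> z"
proof -
  obtain z where z: "z \<in> carrier_vec m" "\<psi> z \<le> 1"
    and max: "\<And>y. y \<in> carrier_vec m \<Longrightarrow> \<psi> y \<le> 1 \<Longrightarrow> b \<bullet> y \<le> b \<bullet> z"
    using linear_functional_attains_max[OF b] by blast
  have abs_le: "\<bar>b \<bullet> y\<bar> \<le> b \<bullet> z" if y: "y \<in> carrier_vec m" "\<psi> y \<le> 1" for y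
  proof -
    have "\<psi> (- y) = \<psi> y" using y by (intro gauge_cong_abs) auto
    then have "b \<bullet> (- y) \<le> b \<bullet> z" using max[of "- y"] y by simp
    then show ?thesis using max[OF y] y b by auto
  qed
  have nonneg: "\<bar>b \<bullet> z\<bar> = b \<bullet> z" using abs_le[OF z] by simp
  have "dual_norm m \<psi> b = b \<bullet> z"
    unfolding dual_norm_def maximum_def
  proof (rule Greatest_equality)
    show "b \<bullet> z \<in> (\<lambda>z. \<bar>b \<bullet> z\<bar>) ` {z \<in> carrier_vec m. \<psi> z \<le> 1}"
      using z nonneg by (intro image_eqI[of _ _ z]) auto
  qed (use abs_le in auto)
  then show ?thesis using that z abs_le by blast
qed

lemma scalar_prod_le_dual_norm:
  assumes "b \<in> carrier_vec m" "y \<in> carrier_vec m" "\<psi> y \<le> 1"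
  shows "b \<bullet> y \<le> dual_norm m \<psi> b"
  using dual_norm_attained[OF assms(1)] assms(2,3) by (metis abs_le_D1)

text \<open>
  From any maximiser, taking absolute values and deleting the coordinates where \<open>b\<close> vanishes keeps
  \<open>z\<close> in the ball and does not decrease \<open>b \<bullet> z\<close>.
\<close>

lemma dual_norm_attained_nonneg:
  assumes b: "b \<in> carrier_vec m" and nonneg: "\<And>i. i < m \<Longrightarrow> 0 \<le> b $ i"
  obtains z where "z \<in> carrier_vec m" "\<And>i. i < m \<Longrightarrow> 0 \<le> z $ i" "\<psi> z \<le> 1"
    "vec_supp z \<subseteq> vec_supp b" "dual_norm m \<psi> b = b \<bullet> z"
proof -
  obtain y where y: "y \<in> carrier_vec m" "\<psi> y \<le> 1" and eq: "dual_norm m \<psi> b = b \<bullet> y"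
    using dual_norm_attained[OF b] by blast
  let ?a = "map_vec abs y"
  define z where "z = vec m (\<lambda>i. if i \<in> vec_supp b then ?a $ i else 0)"
  have "\<psi> z \<le> \<psi> ?a"
    unfolding z_def using y by (intro gauge_restrict_le) auto
  also have "\<psi> ?a = \<psi> y"
    using y by (intro gauge_cong_abs) auto
  finally have z_le: "\<psi> z \<le> 1" using y by simp
  have z: "z \<in> carrier_vec m" by (simp add: z_def)
  have "b \<bullet> y \<le> b \<bullet> z"
  proof -
    have "b $ i * y $ i \<le> b $ i * z $ i" if "i < m" for i
      using that y b nonneg by (cases "b $ i = 0") (auto simp: z_def vec_supp_def intro!: mult_left_mono)
    then show ?thesis
      using y z by (auto simp: scalar_prod_def intro!: sum_mono)
  qed
  then have "dual_norm m \<psi> b = b \<bullet> z"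
    using eq scalar_prod_le_dual_norm[OF b z z_le] by simp
  moreover have "vec_supp z \<subseteq> vec_supp b"
    using b by (auto simp: z_def vec_supp_def split: if_splits)
  ultimately show ?thesis
    using that[of z] z z_le y by (simp add: z_def)
qed

text \<open>
  A nonzero coordinate of \<open>b\<close> is detected by the corresponding normalised unit vector.
\<close>

lemma dual_norm_eq_0_iff:
  assumes b: "b \<in> carrier_vec m"
  shows "dual_norm m \<psi> b = 0 \<longleftrightarrow> b = 0\<^sub>v m"
proof
  assume 0: "dual_norm m \<psi> b = 0"
  have "b $ i = 0" if i: "i < m" for i
  proof -
    obtain z where "dual_norm m \<psi> b = b \<bullet> z"
      and z: "\<And>y. y \<in> carrier_vec m \<Longrightarrow> \<psi> y \<le> 1 \<Longrightarrow> \<bar>b \<bullet> y\<bar> \<le> b \<bullet> z"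
      using dual_norm_attained[OF b] by blast
    moreover let ?e = "(1 / \<psi> (unit_vec m i)) \<cdot>\<^sub>v unit_vec m i"
    have "\<psi> ?e \<le> 1"
      using gauge_unit_pos[OF i] by (simp add: gauge_smult)
    ultimately have "b \<bullet> ?e = 0" using 0 z[of ?e] by simp
    then show ?thesis
      using b i gauge_unit_pos[OF i] by simp
  qed
  then show "b = 0\<^sub>v m" using b by (intro eq_vecI) auto
next
  assume "b = 0\<^sub>v m"
  then show "dual_norm m \<psi> b = 0"
    using dual_norm_attained[OF b] by (metis scalar_prod_left_zero)
qed

end

section \<open>A rearrangement inequality for doubly stochastic matrices\<close>

text \<open>
  Fractional weights of total mass \<open>l\<close> are best concentrated on the \<open>l\<close> largest values. With the
  threshold \<open>c = b l\<close> (or \<open>0\<close> when \<open>l = k\<close>) separating these from the rest, a corrected inequality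
  holds term by term.
\<close>

lemma weighted_sum_le_prefix_sum:
  fixes b w :: "nat \<Rightarrow> real"
  assumes mono: "\<And>i j. i \<le> j \<Longrightarrow> j < k \<Longrightarrow> b j \<le> b i" and nonneg: "\<And>i. i < k \<Longrightarrow> 0 \<le> b i"
    and w: "\<And>i. i < k \<Longrightarrow> 0 \<le> w i \<and> w i \<le> 1" and sum: "(\<Sum>i<k. w i) = real l" and "l \<le> k"
  shows "(\<Sum>i<k. b i * w i) \<le> (\<Sum>i<l. b i)"
proof -
  define c where "c = (if l < k then b l else 0)"
  have "b i * w i \<le> (if i < l then b i - c else 0) + c * w i" if i: "i < k" for i
  proof (cases "i < l")
    case True
    have "c \<le> b i" using mono[of i l] nonneg[OF i] True by (simp add: c_def)
    then have "0 \<le> (b i - c) * (1 - w i)" using w[OF i] by simp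
    then show ?thesis using True by (simp add: algebra_simps)
  next
    case False
    have "b i \<le> c" using mono[of l i] False i by (simp add: c_def)
    then show ?thesis using False w[OF i] by (simp add: mult_right_mono)
  qed
  then have "(\<Sum>i<k. b i * w i) \<le> (\<Sum>i<k. (if i < l then b i - c else 0) + c * w i)"
    by (intro sum_mono) simp
  also have "\<dots> = (\<Sum>i<k. if i < l then b i - c else 0) + c * real l"
    by (simp add: sum.distrib sum flip: sum_distrib_left)
  also have "(\<Sum>i<k. if i < l then b i - c else 0) = (\<Sum>i<l. b i - c)"
  proof -
    have "{..<k} \<inter> {i. i < l} = {..<l}" using \<open>l \<le> k\<close> by auto
    then show ?thesis by (simp add: sum.If_cases)
  qed
  finally show ?thesis by (simp add: sum_subtractf)
qed

text \<open>
  Summation by parts, in the form of an induction on the stronger claim that a partial sum dominates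
  its last weight times the partial sum of \<open>d\<close>.
\<close>

lemma sum_antimono_weights_nonneg:
  fixes d s :: "nat \<Rightarrow> real"
  assumes mono: "\<And>i j. i \<le> j \<Longrightarrow> j < k \<Longrightarrow> s j \<le> s i" and nonneg: "\<And>i. i < k \<Longrightarrow> 0 \<le> s i"
    and prefix: "\<And>l. l \<le> k \<Longrightarrow> 0 \<le> (\<Sum>j<l. d j)"
  shows "0 \<le> (\<Sum>j<k. d j * s j)"
proof -
  have step: "s l * (\<Sum>j<Suc l. d j) \<le> (\<Sum>j<Suc l. d j * s j)" if "l < k" for l
    using that
  proof (induction l)
    case 0
    then show ?case by (simp add: mult.commute)
  next
    case (Suc l)
    have "s (Suc l) * (\<Sum>j<Suc l. d j) \<le> s l * (\<Sum>j<Suc l. d j)"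
      using Suc.prems mono[of l "Suc l"] prefix[of "Suc l"] by (intro mult_right_mono) auto
    then have "s (Suc l) * (\<Sum>j<Suc l. d j) \<le> (\<Sum>j<Suc l. d j * s j)"
      using Suc by simp
    then show ?case
      by (simp add: distrib_left mult.commute[of "d (Suc l)"])
  qed
  show ?thesis
  proof (cases k)
    case (Suc l)
    have "0 \<le> s l * (\<Sum>j<Suc l. d j)"
      using Suc nonneg[of l] prefix[of k] by (intro mult_nonneg_nonneg) auto
    then show ?thesis using step[of l] Suc by simp
  qed simp
qed

text \<open>
  The sequence \<open>c = D\<^sup>T b\<close> is majorised by \<open>b\<close>, so \<open>b - c\<close> has nonnegative prefix sums and pairs
  nonnegatively with the nonincreasing \<open>s\<close>.
\<close>

lemma doubly_stochastic_rearrangement: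
  fixes D :: "nat \<Rightarrow> nat \<Rightarrow> real" and b s :: "nat \<Rightarrow> real"
  assumes D: "\<And>i j. i < k \<Longrightarrow> j < k \<Longrightarrow> 0 \<le> D i j"
    and row: "\<And>i. i < k \<Longrightarrow> (\<Sum>j<k. D i j) = 1" and col: "\<And>j. j < k \<Longrightarrow> (\<Sum>i<k. D i j) = 1"
    and b: "\<And>i j. i \<le> j \<Longrightarrow> j < k \<Longrightarrow> b j \<le> b i" "\<And>i. i < k \<Longrightarrow> 0 \<le> b i"
    and s: "\<And>i j. i \<le> j \<Longrightarrow> j < k \<Longrightarrow> s j \<le> s i" "\<And>i. i < k \<Longrightarrow> 0 \<le> s i"
  shows "(\<Sum>i<k. \<Sum>j<k. b i * D i j * s j) \<le> (\<Sum>i<k. b i * s i)"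
proof -
  define c where "c j = (\<Sum>i<k. b i * D i j)" for j
  have "0 \<le> (\<Sum>j<k. (b j - c j) * s j)"
  proof (rule sum_antimono_weights_nonneg[OF s])
    fix l assume l: "l \<le> k"
    let ?w = "\<lambda>i. \<Sum>j<l. D i j"
    have "(\<Sum>j<l. c j) = (\<Sum>i<k. b i * ?w i)"
      unfolding c_def by (subst sum.swap) (simp add: sum_distrib_left)
    also have "\<dots> \<le> (\<Sum>i<l. b i)"
    proof (rule weighted_sum_le_prefix_sum[OF b _ _ l])
      show "0 \<le> ?w i \<and> ?w i \<le> 1" if i: "i < k" for i
      proof
        show "0 \<le> ?w i" using D[OF i] l by (intro sum_nonneg) auto
        have "?w i \<le> (\<Sum>j<k. D i j)" using D[OF i] l by (intro sum_mono2) auto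
        then show "?w i \<le> 1" using row[OF i] by simp
      qed
      have "(\<Sum>i<k. ?w i) = (\<Sum>j<l. \<Sum>i<k. D i j)" by (rule sum.swap)
      also have "\<dots> = (\<Sum>j<l. 1)" using l col by (intro sum.cong) auto
      finally show "(\<Sum>i<k. ?w i) = real l" by simp
    qed
    finally show "0 \<le> (\<Sum>j<l. b j - c j)" by (simp add: sum_subtractf)
  qed
  also have "(\<Sum>j<k. (b j - c j) * s j) = (\<Sum>i<k. b i * s i) - (\<Sum>j<k. \<Sum>i<k. b i * D i j * s j)"
    by (simp add: c_def left_diff_distrib sum_subtractf sum_distrib_right)
  also have "(\<Sum>j<k. \<Sum>i<k. b i * D i j * s j) = (\<Sum>i<k. \<Sum>j<k. b i * D i j * s j)"
    by (rule sum.swap)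
  finally show ?thesis by simp
qed

section \<open>The spectral theorem for real symmetric matrices\<close>

lemma sym_matsD: "A \<in> sym_mats n \<Longrightarrow> A \<in> carrier_mat n n" "A \<in> sym_mats n \<Longrightarrow> A\<^sup>T = A"
  by (auto simp: sym_mats_def)

lemma orthogonal_matsD:
  assumes "Q \<in> orthogonal_mats n"
  shows "Q \<in> carrier_mat n n" "Q\<^sup>T * Q = 1\<^sub>m n" "Q * Q\<^sup>T = 1\<^sub>m n"
  using assms by (auto simp: orthogonal_mats_def)

lemma orthogonal_mats_transpose: "Q \<in> orthogonal_mats n \<Longrightarrow> Q\<^sup>T \<in> orthogonal_mats n"
  by (auto simp: orthogonal_mats_def)

lemma mult_left_inverse_cancel:
  fixes P :: "real mat"
  assumes "P \<in> carrier_mat n n" "Q \<in> carrier_mat n n" "Q * P = 1\<^sub>m n" "A \<in> carrier_mat n k"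
  shows "Q * (P * A) = A"
  using assms by (metis assoc_mult_mat left_mult_one_mat)

lemma orthogonal_mats_mult:
  assumes "P \<in> orthogonal_mats n" "Q \<in> orthogonal_mats n"
  shows "P * Q \<in> orthogonal_mats n"
proof -
  note P = orthogonal_matsD[OF assms(1)] and Q = orthogonal_matsD[OF assms(2)]
  have T: "(P * Q)\<^sup>T = Q\<^sup>T * P\<^sup>T"
    using P Q by (intro transpose_mult) auto
  have "Q\<^sup>T * P\<^sup>T * (P * Q) = Q\<^sup>T * (P\<^sup>T * (P * Q))"
    using P(1) Q(1) by (intro assoc_mult_mat) auto
  also have "\<dots> = 1\<^sub>m n"
    using P Q by (simp add: mult_left_inverse_cancel[of P n "P\<^sup>T" Q n])
  finally have 1: "Q\<^sup>T * P\<^sup>T * (P * Q) = 1\<^sub>m n" .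
  have "P * Q * (Q\<^sup>T * P\<^sup>T) = P * (Q * (Q\<^sup>T * P\<^sup>T))"
    using P(1) Q(1) by (intro assoc_mult_mat) auto
  also have "\<dots> = 1\<^sub>m n"
    using P Q by (simp add: mult_left_inverse_cancel[of "Q\<^sup>T" n Q "P\<^sup>T" n])
  finally show ?thesis
    using 1 P Q by (auto simp: orthogonal_mats_def T)
qed

lemma transpose_conjugation:
  fixes A :: "real mat"
  assumes "W \<in> carrier_mat n k" "A \<in> carrier_mat k k"
  shows "(W * A * W\<^sup>T)\<^sup>T = W * A\<^sup>T * W\<^sup>T"
proof -
  have "(W * A * W\<^sup>T)\<^sup>T = W * (W * A)\<^sup>T"
    using assms by (subst transpose_mult[of _ n k _ n]) auto
  also have "(W * A)\<^sup>T = A\<^sup>T * W\<^sup>T"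
    using assms by (intro transpose_mult) auto
  finally show ?thesis
    using assms by (simp add: assoc_mult_mat[of W n k "A\<^sup>T" k "W\<^sup>T" n])
qed

lemma sym_mats_conjugation:
  "W \<in> carrier_mat n k \<Longrightarrow> A \<in> sym_mats k \<Longrightarrow> W * A * W\<^sup>T \<in> sym_mats n"
  by (auto simp: sym_mats_def transpose_conjugation intro!: mult_carrier_mat)

lemma conjugation_conjugation:
  fixes A :: "real mat"
  assumes "V \<in> carrier_mat m n" "W \<in> carrier_mat n k" "A \<in> carrier_mat k k"
  shows "V * (W * A * W\<^sup>T) * V\<^sup>T = (V * W) * A * (V * W)\<^sup>T"
proof -
  have T: "(V * W)\<^sup>T = W\<^sup>T * V\<^sup>T" using assms by (intro transpose_mult) auto
  have "V * (W * A * W\<^sup>T) = V * W * A * W\<^sup>T"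
    using assms by (simp add: assoc_mult_mat[of _ m n _ k _ k] assoc_mult_mat[of _ m n _ k _ n]
        assoc_mult_mat[of _ n k _ k _ n] assoc_mult_mat[of _ m k _ k _ n])
  then show ?thesis
    using assms by (simp add: T assoc_mult_mat[of _ m k _ n _ m])
qed

lemma orthogonal_conjugation_inverse:
  fixes A :: "real mat"
  assumes Q: "Q \<in> orthogonal_mats n" and A: "A \<in> carrier_mat n n"
  shows "Q\<^sup>T * (Q * A * Q\<^sup>T) * Q = A"
proof -
  note Q' = orthogonal_matsD[OF Q]
  have "Q\<^sup>T * (Q * A * Q\<^sup>T) * Q\<^sup>T\<^sup>T = Q\<^sup>T * Q * A * (Q\<^sup>T * Q)\<^sup>T"
    using Q' A by (intro conjugation_conjugation) auto
  then show ?thesis using Q' A by simp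
qed

lemma similar_orthogonal_conjugation:
  fixes A :: "real mat"
  assumes "Q \<in> orthogonal_mats n" "A \<in> carrier_mat n n"
  shows "similar_mat (Q * A * Q\<^sup>T) A"
  using orthogonal_matsD[OF assms(1)] assms(2)
  by (intro similar_matI[of _ _ Q "Q\<^sup>T" n]) auto

text \<open>
  The reflection in the hyperplane orthogonal to \<open>u = v - e\<^sub>0\<close> exchanges \<open>e\<^sub>0\<close> and \<open>v\<close>. For \<open>v = e\<^sub>0\<close>
  the coefficient \<open>2 / (u \<bullet> u)\<close> is \<open>2 / 0 = 0\<close>, and the formula yields the identity.
\<close>

lemma householder_reflection:
  assumes v: "v \<in> carrier_vec (Suc m)" and unit: "v \<bullet> v = 1"
  shows "\<exists>H \<in> orthogonal_mats (Suc m). H *\<^sub>v unit_vec (Suc m) 0 = v"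
proof -
  let ?n = "Suc m"
  define u where "u = v - unit_vec ?n 0"
  define c where "c = 2 / (u \<bullet> u)"
  define H where "H = mat ?n ?n (\<lambda>(i, j). (if i = j then 1 else 0) - c * (u $ i * u $ j))"
  have u: "u \<in> carrier_vec ?n" using v by (simp add: u_def)
  have uu: "(\<Sum>i<?n. u $ i * u $ i) = u \<bullet> u"
    using u by (simp add: scalar_prod_def atLeast0LessThan)
  \<comment> \<open>Covers both \<open>u \<noteq> 0\<close>, where \<open>c (u \<bullet> u) = 2\<close>, and \<open>u = 0\<close>, where both sides vanish.\<close>
  have cu: "c * (u \<bullet> u) * u $ i = 2 * u $ i" if "i < ?n" for i
  proof (cases "u \<bullet> u = 0")
    case True
    then have "u $ i * u $ i = 0"
      using uu that sum_nonneg_eq_0_iff[of "{..<?n}" "\<lambda>i. u $ i * u $ i"] by simp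
    then show ?thesis by simp
  qed (simp add: c_def)
  have "H * H = 1\<^sub>m ?n"
  proof (rule eq_matI)
    fix i j assume "i < dim_row (1\<^sub>m ?n :: real mat)" "j < dim_col (1\<^sub>m ?n :: real mat)"
    then have ij: "i < ?n" "j < ?n" by auto
    have "(H * H) $$ (i, j) = (\<Sum>l<?n. ((if i = l then 1 else 0) - c * (u $ i * u $ l)) *
        ((if l = j then 1 else 0) - c * (u $ l * u $ j)))"
      using ij by (simp add: H_def scalar_prod_def atLeast0LessThan)
    also have "\<dots> = (\<Sum>l<?n. (if i = l then (if l = j then 1 else 0) else 0)
        - (if i = l then c * (u $ l * u $ j) else 0) - (if l = j then c * (u $ i * u $ l) else 0)
        + (c * c * u $ i * u $ j) * (u $ l * u $ l))"
      by (intro sum.cong) (auto simp: algebra_simps)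
    also have "\<dots> = (if i = j then 1 else 0) - c * (u $ i * u $ j) - c * (u $ i * u $ j)
        + (c * c * u $ i * u $ j) * (u \<bullet> u)"
      using ij by (simp only: sum.distrib sum_subtractf uu flip: sum_distrib_left) simp
    also have "(c * c * u $ i * u $ j) * (u \<bullet> u) = c * u $ j * (c * (u \<bullet> u) * u $ i)"
      by simp
    finally show "(H * H) $$ (i, j) = 1\<^sub>m ?n $$ (i, j)"
      unfolding cu[OF ij(1)] using ij by (simp add: algebra_simps)
  qed (auto simp: H_def)
  moreover have "H\<^sup>T = H"
    by (rule eq_matI) (auto simp: H_def mult.commute)
  ultimately have "H \<in> orthogonal_mats ?n"
    by (auto simp: orthogonal_mats_def H_def)
  moreover have "H *\<^sub>v unit_vec ?n 0 = v"
  proof (rule eq_vecI)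
    have "u \<bullet> u = v \<bullet> v - 2 * v $ 0 + 1"
      using v unfolding u_def
      by (simp add: minus_scalar_prod_distrib[of _ ?n] scalar_prod_minus_distrib[of _ ?n])
    \<comment> \<open>For a unit vector \<open>v\<close> we have \<open>c u\<^sub>0 u = - u\<close>, so the first column of \<open>H\<close> is \<open>e\<^sub>0 + u\<close>.\<close>
    then have uu2: "u \<bullet> u = - 2 * u $ 0"
      using unit v by (simp add: u_def)
    have cu0: "c * (u $ i * u $ 0) = - u $ i" if "i < ?n" for i
      using cu[OF that] unfolding uu2 by (simp add: algebra_simps)
    fix i assume "i < dim_vec v"
    then have i: "i < ?n" using v by simp
    have "(H *\<^sub>v unit_vec ?n 0) $ i = H $$ (i, 0)"
      using i by (simp add: H_def)
    also have "\<dots> = (if i = 0 then 1 else 0) + u $ i"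
      using i cu0[OF i] by (simp add: H_def)
    also have "\<dots> = v $ i"
      using i v by (simp add: u_def)
    finally show "(H *\<^sub>v unit_vec ?n 0) $ i = v $ i" .
  qed (use v in \<open>simp add: H_def\<close>)
  ultimately show ?thesis by blast
qed

lemma proots_linear_factors:
  fixes rs :: "'a :: idom list"
  shows "proots (\<Prod>a\<leftarrow>rs. [:- a, 1:]) = mset rs"
proof (induction rs)
  case (Cons a rs)
  have "(\<Prod>a\<leftarrow>rs. [:- a, 1:]) \<noteq> 0"
    by (auto simp: prod_list_zero_iff)
  then show ?case
    using Cons by (simp add: proots_mult del: mult_pCons_left)
qed simp

text \<open>
  Over the complex numbers the characteristic polynomial splits, and each of its roots is real because
  \<open>a (v \<bullet> cnj v) = (A v) \<bullet> cnj v = v \<bullet> cnj (A v) = cnj a (v \<bullet> cnj v)\<close> for an eigenvector \<open>v\<close>.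
\<close>

lemma char_poly_sym_splits:
  assumes A: "A \<in> sym_mats n"
  shows "char_poly A = (\<Prod>a\<leftarrow>sorted_list_of_multiset (proots (char_poly A)). [:- a, 1:])"
proof -
  let ?B = "map_mat complex_of_real A"
  note A' = sym_matsD[OF A]
  have B: "?B \<in> carrier_mat n n" "?B\<^sup>T = ?B"
    using A' map_mat_transpose[of complex_of_real A] by auto
  interpret hp: map_poly_inj_idom_hom complex_of_real ..
  have hom: "char_poly ?B = map_poly complex_of_real (char_poly A)"
    by (rule of_real_hom.char_poly_hom[OF A'(1)])
  obtain cs where cs: "char_poly ?B = (\<Prod>a\<leftarrow>cs. [:- a, 1:])"
    using char_poly_factorized[OF B(1)] by blast
  have real: "complex_of_real (Re a) = a" if a: "a \<in> set cs" for a
  proof -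
    have "poly (char_poly ?B) a = 0"
      using a unfolding cs by (auto simp: poly_prod_list prod_list_zero_iff o_def)
    then obtain v where v: "v \<in> carrier_vec n" "v \<noteq> 0\<^sub>v n" and ev: "?B *\<^sub>v v = a \<cdot>\<^sub>v v"
      using B(1) unfolding eigenvalue_root_char_poly[OF B(1), symmetric] eigenvalue_def eigenvector_def
      by auto
    have conj: "?B *\<^sub>v conjugate v = conjugate (?B *\<^sub>v v)"
    proof (rule eq_vecI)
      fix i assume "i < dim_vec (conjugate (?B *\<^sub>v v))"
      then have i: "i < n" using A' by simp
      have "conjugate (row ?B i) = row ?B i"
        using i A' by (intro eq_vecI) auto
      then show "(?B *\<^sub>v conjugate v) $ i = conjugate (?B *\<^sub>v v) $ i"
        using i B v conjugate_sprod_vec[of "row ?B i" n v] A' by simp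
    qed (use A' in simp)
    have "a * (v \<bullet>c v) = (?B\<^sup>T *\<^sub>v v) \<bullet>c v"
      using v B by (simp add: ev)
    also have "\<dots> = v \<bullet> (?B *\<^sub>v conjugate v)"
      using v B by (intro transpose_vec_mult_scalar) auto
    also have "\<dots> = cnj a * (v \<bullet>c v)"
      using v unfolding conj ev by (simp add: conjugate_smult_vec)
    finally have "a = cnj a"
      using v conjugate_square_eq_0_vec[OF v(1)] by simp
    then show ?thesis by (simp add: complex_eq_iff)
  qed
  define rs where "rs = map Re cs"
  have "map_poly complex_of_real (\<Prod>a\<leftarrow>rs. [:- a, 1:]) = (\<Prod>a\<leftarrow>cs. [:- a, 1:])"
    using real unfolding rs_def
    by (induction cs) (auto simp: hp.hom_mult simp del: mult_pCons_left)
  then have rs: "char_poly A = (\<Prod>a\<leftarrow>rs. [:- a, 1:])"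
    using hom cs hp.eq_iff by metis
  have "mset (sorted_list_of_multiset (proots (char_poly A))) = mset rs"
    using rs by (simp add: proots_linear_factors)
  then have "mset (map (\<lambda>a. [:- a, 1:]) (sorted_list_of_multiset (proots (char_poly A)))) =
      mset (map (\<lambda>a. [:- a, 1:]) rs)"
    by simp
  then show ?thesis
    using rs by (metis prod_mset_prod_list)
qed

lemma diag_of_vec_carrier [simp]: "diag_of_vec v \<in> carrier_mat (dim_vec v) (dim_vec v)"
  and diag_of_vec_dim [simp]: "dim_row (diag_of_vec v) = dim_vec v" "dim_col (diag_of_vec v) = dim_vec v"
  by (auto simp: diag_of_vec_def mat_diag_def)

lemma diag_of_vec_index [simp]:
  "i < dim_vec v \<Longrightarrow> j < dim_vec v \<Longrightarrow> diag_of_vec v $$ (i, j) = (if i = j then v $ i else 0)"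
  by (simp add: diag_of_vec_def mat_diag_def)

text \<open>
  Prescribing the order of the eigenvalues makes the sorted diagonalisation an instance. The induction
  deflates: a reflection moves a unit eigenvector for the first prescribed eigenvalue to \<open>e\<^sub>0\<close>, and symmetry
  turns the conjugated matrix into a block diagonal one.
\<close>

lemma spectral_theorem_ordered:
  fixes A :: "real mat"
  assumes "A \<in> sym_mats n" "char_poly A = (\<Prod>a\<leftarrow>es. [:- a, 1:])"
  shows "\<exists>Q \<in> orthogonal_mats n. A = Q * diag_of_vec (vec_of_list es) * Q\<^sup>T"
  using assms
proof (induction es arbitrary: n A)
  case Nil
  then have "n = 0"
    using degree_monic_char_poly[of A n] sym_matsD(1)[of A n] by simp
  then show ?case
    using sym_matsD(1)[OF Nil.prems(1)]
    by (intro bexI[of _ "1\<^sub>m 0"]) (auto simp: orthogonal_mats_def intro!: eq_matI)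
next
  case (Cons e es)
  note A = sym_matsD[OF Cons.prems(1)]
  have "degree (char_poly A) = Suc (length es)"
    using Cons.prems(2) degree_linear_factors[of uminus "e # es"] by simp
  then obtain m where n: "n = Suc m"
    using degree_monic_char_poly[OF A(1)] by auto
  have "poly (char_poly A) e = 0"
    using Cons.prems(2) by simp
  then obtain w where w: "w \<in> carrier_vec n" "w \<noteq> 0\<^sub>v n" and ew: "A *\<^sub>v w = e \<cdot>\<^sub>v w"
    using A(1) unfolding eigenvalue_root_char_poly[OF A(1), symmetric] eigenvalue_def eigenvector_def
    by auto
  define v where "v = (1 / sqrt (w \<bullet> w)) \<cdot>\<^sub>v w"
  have "w \<bullet> w > 0"
    using w conjugate_square_greater_0_vec[of w n] by simp
  then have "v \<bullet> v = 1"
    using w by (simp add: v_def field_simps)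
  moreover have v: "v \<in> carrier_vec n" using w by (simp add: v_def)
  ultimately obtain H where H: "H \<in> orthogonal_mats n" and Hv: "H *\<^sub>v unit_vec n 0 = v"
    using householder_reflection[of v m] n by auto
  note H' = orthogonal_matsD[OF H]
  have ev: "A *\<^sub>v v = e \<cdot>\<^sub>v v"
    using w A by (simp add: v_def mult_mat_vec[of A n n] ew smult_smult_assoc mult.commute)
  define A' where "A' = H\<^sup>T * A * H"
  have A'_sym: "A' \<in> sym_mats n"
    using sym_mats_conjugation[of "H\<^sup>T" n n A] H' Cons.prems(1) by (simp add: A'_def)
  note A' = sym_matsD[OF A'_sym]
  have A_eq: "A = H * A' * H\<^sup>T"
    using orthogonal_conjugation_inverse[OF orthogonal_mats_transpose[OF H] A(1)]
    by (simp add: A'_def)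
  have "A' *\<^sub>v unit_vec n 0 = H\<^sup>T *\<^sub>v (A *\<^sub>v (H *\<^sub>v unit_vec n 0))"
    using H'(1) A(1) by (simp add: A'_def assoc_mult_mat_vec[of _ n n _ n])
  also have "\<dots> = e \<cdot>\<^sub>v (H\<^sup>T *\<^sub>v (H *\<^sub>v unit_vec n 0))"
    using H'(1) v by (simp add: Hv ev mult_mat_vec[of _ n n])
  also have "\<dots> = e \<cdot>\<^sub>v unit_vec n 0"
    using H' by (simp flip: assoc_mult_mat_vec)
  finally have col: "A' *\<^sub>v unit_vec n 0 = e \<cdot>\<^sub>v unit_vec n 0" .
  have col0: "A' $$ (i, 0) = (if i = 0 then e else 0)" if "i < n" for i
  proof -
    have "A' $$ (i, 0) = (A' *\<^sub>v unit_vec n 0) $ i"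
      using A' that n by simp
    then show ?thesis using that unfolding col by simp
  qed
  \<comment> \<open>Symmetry clears the first row as well.\<close>
  have row0: "A' $$ (0, i) = (if i = 0 then e else 0)" if "i < n" for i
    using col0[OF that] A' that n by (metis carrier_matD index_transpose_mat(1) zero_less_Suc)
  define B where "B = mat m m (\<lambda>(i, j). A' $$ (Suc i, Suc j))"
  let ?e = "mat 1 1 (\<lambda>_. e)"
  have block: "A' = four_block_mat ?e (0\<^sub>m 1 m) (0\<^sub>m m 1) B"
    using A' n col0 row0 by (intro eq_matI) (auto simp: B_def)
  have B: "B \<in> sym_mats m"
    using A' n by (auto simp: sym_mats_def B_def intro!: eq_matI)
      (metis Suc_less_eq carrier_matD index_transpose_mat(1))
  have "char_poly A = char_poly A'"
    using similar_orthogonal_conjugation[OF H A'(1)] by (metis A_eq char_poly_similar)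
  also have "\<dots> = char_poly ?e * char_poly B"
    unfolding block using sym_matsD(1)[OF B] by (intro char_poly_four_block_zeros_col) auto
  also have "char_poly ?e = [:- e, 1:]"
    by (subst char_poly_upper_triangular[of _ 1]) (auto simp: diag_mat_def)
  finally have "[:- e, 1:] * (\<Prod>a\<leftarrow>es. [:- a, 1:]) = [:- e, 1:] * char_poly B"
    using Cons.prems(2) by simp
  then have "char_poly B = (\<Prod>a\<leftarrow>es. [:- a, 1:])"
    by (metis mult_left_cancel pCons_eq_0_iff zero_neq_one)
  then obtain R where R: "R \<in> orthogonal_mats m" and B_eq: "B = R * diag_of_vec (vec_of_list es) * R\<^sup>T"
    using Cons.IH[OF B] by blast
  note R' = orthogonal_matsD[OF R]
  have "dim_vec (vec_of_list es) = m"
    using \<open>degree (char_poly A) = _\<close> degree_monic_char_poly[OF A(1)] n by simp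
  define D where "D = diag_of_vec (vec_of_list es)"
  have D: "D \<in> carrier_mat m m"
    using diag_of_vec_carrier[of "vec_of_list es"] by (simp only: \<open>dim_vec _ = m\<close> D_def)
  let ?R = "four_block_mat (1\<^sub>m 1) (0\<^sub>m 1 m) (0\<^sub>m m 1) R"
  have R_T: "?R\<^sup>T = four_block_mat (1\<^sub>m 1) (0\<^sub>m 1 m) (0\<^sub>m m 1) R\<^sup>T"
    using R' by (subst transpose_four_block_mat) auto
  have R_orth: "?R \<in> orthogonal_mats n"
    using R' n unfolding orthogonal_mats_def mem_Collect_eq R_T
    by (auto simp: mult_four_block_mat[of _ 1 1 _ m _ m _ _ 1 _ m])
  have "diag_of_vec (vec_of_list (e # es)) = four_block_mat ?e (0\<^sub>m 1 m) (0\<^sub>m m 1) D"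
    using \<open>dim_vec _ = m\<close> by (intro eq_matI) (auto simp: D_def vec_index_vCons vec_of_list_index)
  then have "?R * diag_of_vec (vec_of_list (e # es)) * ?R\<^sup>T = A'"
    using R' D unfolding R_T block B_eq D_def[symmetric]
    by (simp add: mult_four_block_mat[of _ 1 1 _ m _ m _ _ 1 _ m])
  then have "A = H * ?R * diag_of_vec (vec_of_list (e # es)) * (H * ?R)\<^sup>T"
    using conjugation_conjugation[of H n n ?R n "diag_of_vec (vec_of_list (e # es))"]
      H' orthogonal_matsD(1)[OF R_orth] diag_of_vec_carrier[of "vec_of_list (e # es)"]
      \<open>dim_vec _ = m\<close> n A_eq by simp
  then show ?case
    using orthogonal_mats_mult[OF H R_orth] by blast
qed

section \<open>Eigenvalues, positive semidefiniteness and the Frobenius inner product\<close>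

lemma spectral_theorem:
  assumes "A \<in> sym_mats n"
  obtains Q where "Q \<in> orthogonal_mats n" "A = Q * diag_of_vec (eigvals A) * Q\<^sup>T"
  using spectral_theorem_ordered[OF assms char_poly_sym_splits[OF assms]] unfolding eigvals_def by blast

lemma eigvals_carrier:
  assumes "A \<in> sym_mats n"
  shows "eigvals A \<in> carrier_vec n"
proof -
  let ?es = "sorted_list_of_multiset (proots (char_poly A))"
  have "n = degree (char_poly A)"
    using degree_monic_char_poly[OF sym_matsD(1)[OF assms]] by simp
  also have "\<dots> = degree (\<Prod>a\<leftarrow>?es. [:- a, 1:])"
    by (rule arg_cong[OF char_poly_sym_splits[OF assms]])
  also have "\<dots> = length ?es"
    using degree_linear_factors[of uminus ?es] by simp
  finally show ?thesis
    unfolding eigvals_def by (intro carrier_vecI) simp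
qed

lemma eigvals_mono:
  assumes "i \<le> j" "j < dim_vec (eigvals A)"
  shows "eigvals A $ i \<le> eigvals A $ j"
  using assms sorted_nth_mono[OF sorted_sorted_list_of_multiset, of i j "proots (char_poly A)"]
  by (simp add: eigvals_def vec_of_list_index)

text \<open>
  Equality holds only up to order, since \<^const>\<open>eigvals\<close> sorts.
\<close>

lemma mset_eigvals_conjugated_diag:
  assumes Q: "Q \<in> orthogonal_mats n" and z: "z \<in> carrier_vec n"
  shows "mset (list_of_vec (eigvals (Q * diag_of_vec z * Q\<^sup>T))) = mset (list_of_vec z)"
proof -
  have D: "diag_of_vec z \<in> carrier_mat n n"
    using z diag_of_vec_carrier[of z] by simp
  have "char_poly (Q * diag_of_vec z * Q\<^sup>T) = char_poly (diag_of_vec z)"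
    using similar_orthogonal_conjugation[OF Q D] by (rule char_poly_similar)
  also have "\<dots> = (\<Prod>a\<leftarrow>diag_mat (diag_of_vec z). [:- a, 1:])"
    using z by (intro char_poly_upper_triangular[OF D]) auto
  also have "diag_mat (diag_of_vec z) = list_of_vec z"
    by (intro nth_equalityI) (auto simp: diag_mat_def list_of_vec_index)
  finally show ?thesis
    by (simp add: eigvals_def proots_linear_factors list_vec)
qed

lemma psd_matsD:
  "A \<in> psd_mats n \<Longrightarrow> A \<in> sym_mats n" "A \<in> psd_mats n \<Longrightarrow> A \<in> carrier_mat n n"
  by (auto simp: psd_mats_def sym_mats_def)

lemma psd_mats_conjugation:
  assumes W: "W \<in> carrier_mat n k" and T: "T \<in> psd_mats k"
  shows "W * T * W\<^sup>T \<in> psd_mats n"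
proof -
  note T' = psd_matsD[OF T]
  have "0 \<le> v \<bullet> ((W * T * W\<^sup>T) *\<^sub>v v)" if v: "v \<in> carrier_vec n" for v
  proof -
    have "(W * T * W\<^sup>T) *\<^sub>v v = (W * T) *\<^sub>v (W\<^sup>T *\<^sub>v v)"
      using W T'(2) v by (intro assoc_mult_mat_vec) auto
    also have "\<dots> = W *\<^sub>v (T *\<^sub>v (W\<^sup>T *\<^sub>v v))"
      using W T'(2) v by (intro assoc_mult_mat_vec) auto
    finally have "v \<bullet> ((W * T * W\<^sup>T) *\<^sub>v v) = (W\<^sup>T *\<^sub>v v) \<bullet> (T *\<^sub>v (W\<^sup>T *\<^sub>v v))"
      using W T'(2) v by (simp add: transpose_vec_mult_scalar[of W n k])
    then show ?thesis
      using T W v by (simp add: psd_mats_def)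
  qed
  then show ?thesis
    using sym_mats_conjugation[OF W T'(1)] by (simp add: psd_mats_def)
qed

lemma psd_diag_entry_nonneg:
  assumes T: "T \<in> psd_mats n" and i: "i < n"
  shows "0 \<le> T $$ (i, i)"
proof -
  have "0 \<le> unit_vec n i \<bullet> (T *\<^sub>v unit_vec n i)"
    using T by (simp add: psd_mats_def)
  then show ?thesis
    using psd_matsD(2)[OF T] i by simp
qed

lemma diag_of_vec_psd:
  assumes z: "z \<in> carrier_vec n" and nonneg: "\<And>i. i < n \<Longrightarrow> 0 \<le> z $ i"
  shows "diag_of_vec z \<in> psd_mats n"
proof -
  have "(diag_of_vec z *\<^sub>v v) $ i = z $ i * v $ i" if "v \<in> carrier_vec n" "i < n" for v i
  proof -
    have "(diag_of_vec z *\<^sub>v v) $ i = (\<Sum>j = 0..<n. (if i = j then z $ i else 0) * v $ j)"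
      using that z by (simp add: scalar_prod_def)
    also have "\<dots> = (\<Sum>j = 0..<n. (if i = j then z $ i * v $ i else 0))"
      by (intro sum.cong) auto
    finally show ?thesis using that by simp
  qed
  then have "0 \<le> v \<bullet> (diag_of_vec z *\<^sub>v v)" if "v \<in> carrier_vec n" for v
    using that z nonneg unfolding scalar_prod_def[of v]
    by (auto intro!: sum_nonneg simp: mult.left_commute[of "v $ _"])
  moreover have "diag_of_vec z \<in> sym_mats n"
    using z by (auto simp: sym_mats_def intro!: eq_matI)
  ultimately show ?thesis by (simp add: psd_mats_def)
qed

lemma trace_mult_commute:
  fixes A B :: "real mat"
  assumes "A \<in> carrier_mat n k" "B \<in> carrier_mat k n"
  shows "trace (A * B) = trace (B * A)"
proof -
  have "trace (A * B) = (\<Sum>i<n. \<Sum>j<k. A $$ (i, j) * B $$ (j, i))"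
    using assms by (simp add: trace_def scalar_prod_def atLeast0LessThan)
  also have "\<dots> = (\<Sum>j<k. \<Sum>i<n. B $$ (j, i) * A $$ (i, j))"
    by (subst sum.swap) (simp add: mult.commute)
  also have "\<dots> = trace (B * A)"
    using assms by (simp add: trace_def scalar_prod_def atLeast0LessThan)
  finally show ?thesis .
qed

text \<open>
  The adjoint of \<open>A \<mapsto> W A W\<^sup>T\<close> is \<open>X \<mapsto> W\<^sup>T X W\<close>. With \<open>W\<close> orthogonal it gives the inner product in an
  eigenbasis, and with \<open>W\<close> a selector it relates lifting and principal blocks.
\<close>

lemma frob_inner_conjugation:
  fixes A :: "real mat"
  assumes W: "W \<in> carrier_mat n k" and A: "A \<in> carrier_mat k k" and X: "X \<in> carrier_mat n n"
  shows "frob_inner (W * A * W\<^sup>T) X = frob_inner A (W\<^sup>T * X * W)"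
proof -
  have "frob_inner (W * A * W\<^sup>T) X = trace (W * (A\<^sup>T * W\<^sup>T * X))"
    unfolding frob_inner_def transpose_conjugation[OF W A]
    using assms by (simp add: assoc_mult_mat[of W n k _ k _ n] assoc_mult_mat[of W n k _ n _ n]
        assoc_mult_mat[of "A\<^sup>T" k k _ n _ n])
  also have "\<dots> = trace (A\<^sup>T * W\<^sup>T * X * W)"
    using assms by (intro trace_mult_commute) auto
  also have "\<dots> = frob_inner A (W\<^sup>T * X * W)"
    using assms by (simp add: frob_inner_def assoc_mult_mat[of "A\<^sup>T" k k _ n _ n]
        assoc_mult_mat[of "A\<^sup>T" k k _ n _ k])
  finally show ?thesis .
qed

lemma frob_inner_diag:
  assumes z: "z \<in> carrier_vec n" and A: "A \<in> carrier_mat n n"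
  shows "frob_inner (diag_of_vec z) A = (\<Sum>i<n. z $ i * A $$ (i, i))"
proof -
  have "((diag_of_vec z)\<^sup>T * A) $$ (i, i) = z $ i * A $$ (i, i)" if i: "i < n" for i
  proof -
    have "((diag_of_vec z)\<^sup>T * A) $$ (i, i) = (\<Sum>j = 0..<n. (if j = i then z $ j else 0) * A $$ (j, i))"
      using i z A by (simp add: scalar_prod_def)
    also have "\<dots> = (\<Sum>j = 0..<n. (if j = i then z $ i * A $$ (i, i) else 0))"
      by (intro sum.cong) auto
    finally show ?thesis using i by simp
  qed
  then show ?thesis
    using z by (simp add: frob_inner_def trace_def)
qed

lemma frob_inner_conjugated_diag:
  assumes Q: "Q \<in> carrier_mat n n" and z: "z \<in> carrier_vec n" and A: "A \<in> carrier_mat n n"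
  shows "frob_inner (Q * diag_of_vec z * Q\<^sup>T) A = (\<Sum>i<n. z $ i * (Q\<^sup>T * A * Q) $$ (i, i))"
proof -
  have D: "diag_of_vec z \<in> carrier_mat n n"
    using z diag_of_vec_carrier[of z] by simp
  have "Q\<^sup>T * A * Q \<in> carrier_mat n n" using Q A by auto
  then show ?thesis
    using frob_inner_conjugation[OF Q D A] frob_inner_diag[OF z] by simp
qed

text \<open>
  The eigenvalues are the diagonal entries of the psd matrix \<open>Q\<^sup>T A Q\<close>.
\<close>

lemma eigvals_psd_nonneg:
  assumes A: "A \<in> psd_mats n" and i: "i < n"
  shows "0 \<le> eigvals A $ i"
proof -
  note A' = psd_matsD[OF A]
  obtain Q where Q: "Q \<in> orthogonal_mats n" and eq: "A = Q * diag_of_vec (eigvals A) * Q\<^sup>T"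
    using spectral_theorem[OF A'(1)] .
  note e = eigvals_carrier[OF A'(1)]
  have "diag_of_vec (eigvals A) \<in> carrier_mat n n"
    using e diag_of_vec_carrier[of "eigvals A"] by simp
  then have "Q\<^sup>T * A * Q = diag_of_vec (eigvals A)"
    using orthogonal_conjugation_inverse[OF Q] eq by metis
  moreover have "Q\<^sup>T * A * Q\<^sup>T\<^sup>T \<in> psd_mats n"
    using orthogonal_matsD(1)[OF Q] A by (intro psd_mats_conjugation) auto
  ultimately have "diag_of_vec (eigvals A) \<in> psd_mats n"
    by simp
  then show ?thesis
    using psd_diag_entry_nonneg[of _ n i] e i by fastforce
qed

text \<open>
  In an eigenbasis of \<open>A\<close>, this is a sum of products of eigenvalues of \<open>A\<close> and diagonal entries of a
  psd matrix.
\<close>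

lemma frob_inner_psd_nonneg:
  assumes A: "A \<in> psd_mats n" and B: "B \<in> psd_mats n"
  shows "0 \<le> frob_inner A B"
proof -
  note A' = psd_matsD[OF A] and B' = psd_matsD[OF B]
  obtain Q where Q: "Q \<in> orthogonal_mats n" and eq: "A = Q * diag_of_vec (eigvals A) * Q\<^sup>T"
    using spectral_theorem[OF A'(1)] .
  note Q' = orthogonal_matsD(1)[OF Q]
  have "Q\<^sup>T * B * Q\<^sup>T\<^sup>T \<in> psd_mats n"
    using Q' B by (intro psd_mats_conjugation) auto
  then have "0 \<le> (\<Sum>i<n. eigvals A $ i * (Q\<^sup>T * B * Q) $$ (i, i))"
    using eigvals_psd_nonneg[OF A] psd_diag_entry_nonneg by (intro sum_nonneg mult_nonneg_nonneg) auto
  also have "\<dots> = frob_inner (Q * diag_of_vec (eigvals A) * Q\<^sup>T) B"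
    using frob_inner_conjugated_diag[OF Q' eigvals_carrier[OF A'(1)] B'(2)] by simp
  finally show ?thesis using eq by simp
qed

lemma orthogonal_squares_row_sum:
  assumes V: "V \<in> orthogonal_mats n" and i: "i < n"
  shows "(\<Sum>j<n. (V $$ (i, j))\<^sup>2) = 1"
proof -
  have "(V * V\<^sup>T) $$ (i, i) = (\<Sum>j<n. (V $$ (i, j))\<^sup>2)"
    using orthogonal_matsD(1)[OF V] i
    by (auto simp: scalar_prod_def atLeast0LessThan power2_eq_square)
  then show ?thesis
    using orthogonal_matsD(3)[OF V] i by simp
qed

lemma conjugated_diag_entry:
  assumes V: "V \<in> carrier_mat n n" and a: "a \<in> carrier_vec n" and j: "j < n"
  shows "(V * diag_of_vec a * V\<^sup>T) $$ (j, j) = (\<Sum>i<n. (V $$ (j, i))\<^sup>2 * a $ i)"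
proof -
  have "V * diag_of_vec a = mat n n (\<lambda>(i, j). V $$ (i, j) * a $ j)"
    using mat_diag_mult_right[OF V] a by (simp add: diag_of_vec_def)
  then show ?thesis
    using V j by (simp add: scalar_prod_def atLeast0LessThan power2_eq_square mult_ac)
qed

text \<open>
  The negative parts of the nondecreasing spectrum of \<open>A\<close> form a nonincreasing sequence, so the
  spectrum of \<open>S\<close> is reversed to match it.
\<close>

lemma frob_inner_psd_lower_bound:
  assumes S: "S \<in> psd_mats n" and A: "A \<in> sym_mats n"
  shows "- frob_inner S A \<le> eigvals_neg A \<bullet> vec n (\<lambda>i. eigvals S $ (n - Suc i))"
proof -
  note S' = psd_matsD[OF S] and A' = sym_matsD[OF A]
  define s a b where "s = eigvals S" and "a = eigvals A" and "b = eigvals_neg A"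
  have s: "s \<in> carrier_vec n" and a: "a \<in> carrier_vec n" and b: "b \<in> carrier_vec n"
    using eigvals_carrier[OF S'(1)] eigvals_carrier[OF A] by (auto simp: s_def a_def b_def eigvals_neg_def)
  have b_eq: "b $ i = max (- a $ i) 0" if "i < n" for i
    using that a by (simp add: b_def a_def eigvals_neg_def)
  obtain P where P: "P \<in> orthogonal_mats n" and S_eq: "S = P * diag_of_vec s * P\<^sup>T"
    unfolding s_def using spectral_theorem[OF S'(1)] .
  obtain Q where Q: "Q \<in> orthogonal_mats n" and A_eq: "A = Q * diag_of_vec a * Q\<^sup>T"
    unfolding a_def using spectral_theorem[OF A] .
  define V where "V = P\<^sup>T * Q"
  have V: "V \<in> orthogonal_mats n"
    unfolding V_def using orthogonal_mats_mult[OF orthogonal_mats_transpose[OF P] Q] .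
  note V' = orthogonal_matsD[OF V]
  have "diag_of_vec a \<in> carrier_mat n n"
    using a diag_of_vec_carrier[of a] by simp
  then have PAP: "P\<^sup>T * A * P = V * diag_of_vec a * V\<^sup>T"
    using conjugation_conjugation[of "P\<^sup>T" n n Q n "diag_of_vec a"] orthogonal_matsD(1)[OF P]
      orthogonal_matsD(1)[OF Q] by (simp add: A_eq V_def)
  have "frob_inner S A = (\<Sum>j<n. s $ j * (P\<^sup>T * A * P) $$ (j, j))"
    unfolding S_eq using orthogonal_matsD(1)[OF P] s A'(1) by (intro frob_inner_conjugated_diag) auto
  also have "\<dots> = (\<Sum>j<n. s $ j * (\<Sum>i<n. (V $$ (j, i))\<^sup>2 * a $ i))"
    unfolding PAP using conjugated_diag_entry[OF V'(1) a] by simp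
  finally have "- frob_inner S A = (\<Sum>j<n. s $ j * (\<Sum>i<n. (V $$ (j, i))\<^sup>2 * (- a $ i)))"
    by (simp add: sum_negf)
  also have "\<dots> \<le> (\<Sum>j<n. s $ j * (\<Sum>i<n. (V $$ (j, i))\<^sup>2 * b $ i))"
    using eigvals_psd_nonneg[OF S] b_eq by (intro sum_mono mult_left_mono) (auto simp: s_def)
  \<comment> \<open>Reversing the order of \<open>s\<close> makes both sequences nonincreasing.\<close>
  also have "\<dots> = (\<Sum>j<n. s $ (n - Suc j) * (\<Sum>i<n. (V $$ (n - Suc j, i))\<^sup>2 * b $ i))"
    by (rule sum.nat_diff_reindex[symmetric])
  also have "\<dots> = (\<Sum>i<n. \<Sum>j<n. b $ i * (V $$ (n - Suc j, i))\<^sup>2 * s $ (n - Suc j))"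
    by (subst sum.swap) (simp add: sum_distrib_left mult.assoc mult.left_commute mult.commute)
  also have "\<dots> \<le> (\<Sum>i<n. b $ i * s $ (n - Suc i))"
  proof (rule doubly_stochastic_rearrangement)
    show "(\<Sum>j<n. (V $$ (n - Suc j, i))\<^sup>2) = 1" if "i < n" for i
      using orthogonal_squares_row_sum[OF orthogonal_mats_transpose[OF V] that] V'(1) that
      by (simp add: sum.nat_diff_reindex[of "\<lambda>j. (V $$ (j, i))\<^sup>2"])
    show "(\<Sum>i<n. (V $$ (n - Suc j, i))\<^sup>2) = 1" if "j < n" for j
      using that by (intro orthogonal_squares_row_sum[OF V]) simp
    show "b $ j \<le> b $ i" if "i \<le> j" "j < n" for i j
      using that eigvals_mono[of i j A] a by (simp add: b_eq a_def max_def)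
    show "s $ (n - Suc j) \<le> s $ (n - Suc i)" if "i \<le> j" "j < n" for i j
      using that s unfolding s_def by (intro eigvals_mono) auto
  qed (use b_eq eigvals_psd_nonneg[OF S] in \<open>auto simp: s_def\<close>)
  finally show ?thesis
    by (simp add: scalar_prod_def atLeast0LessThan b_def s_def)
qed

section \<open>Selecting rows and columns\<close>

text \<open>
  The selector of an index list instead of an index set, so that a selector can be completed to a
  permutation matrix by appending the remaining indices.
\<close>

definition list_selector :: "nat \<Rightarrow> nat list \<Rightarrow> real mat" where
  "list_selector n L = mat n (length L) (\<lambda>(i, k). if i = L ! k then 1 else 0)"

lemma list_selector_carrier [simp]: "list_selector n L \<in> carrier_mat n (length L)"
  and list_selector_dim [simp]: "dim_row (list_selector n L) = n" "dim_col (list_selector n L) = length L"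
  by (auto simp: list_selector_def)

lemma selector_eq_list_selector:
  "finite I \<Longrightarrow> selector n I = list_selector n (sorted_list_of_set I)"
  by (simp add: selector_def list_selector_def)

context
  fixes n :: nat and L :: "nat list"
  assumes L: "set L \<subseteq> {..<n}" "distinct L"
begin

lemma list_selector_nth_less: "k < length L \<Longrightarrow> L ! k < n"
  using L(1) nth_mem by blast

lemma col_list_selector: "k < length L \<Longrightarrow> col (list_selector n L) k = unit_vec n (L ! k)"
  using list_selector_nth_less by (intro eq_vecI) (auto simp: list_selector_def)

lemma row_list_selector: "k < length L \<Longrightarrow> row (list_selector n L) (L ! k) = unit_vec (length L) k"
  using list_selector_nth_less nth_eq_iff_index_eq[OF L(2)]
  by (intro eq_vecI) (auto simp: list_selector_def)

lemma row_list_selector_notin: "i < n \<Longrightarrow> i \<notin> set L \<Longrightarrow> row (list_selector n L) i = 0\<^sub>v (length L)"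
  by (intro eq_vecI) (auto simp: list_selector_def)

lemma list_selector_isometry: "(list_selector n L)\<^sup>T * list_selector n L = 1\<^sub>m (length L)"
proof (rule eq_matI)
  fix i j assume "i < dim_row (1\<^sub>m (length L) :: real mat)" "j < dim_col (1\<^sub>m (length L) :: real mat)"
  then show "((list_selector n L)\<^sup>T * list_selector n L) $$ (i, j) = 1\<^sub>m (length L) $$ (i, j)"
    using list_selector_nth_less nth_eq_iff_index_eq[OF L(2)]
    by (simp add: col_list_selector)
qed auto

text \<open>
  Zero-padding, seen on the multiset of entries; compare the effect of lifting on eigenvalues in
  \<open>mset_eigvals_list_selector_expand\<close>.
\<close>

lemma mset_list_selector_mult_vec:
  assumes u: "u \<in> carrier_vec (length L)"
  shows "mset (list_of_vec (list_selector n L *\<^sub>v u)) =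
    mset (list_of_vec u) + replicate_mset (n - length L) 0"
proof -
  let ?w = "list_selector n L *\<^sub>v u"
  have card: "card (set L) = length L"
    using L(2) distinct_card by blast
  have "list_of_vec ?w = map (($) ?w) [0..<n]"
    by (intro nth_equalityI) (auto simp: list_of_vec_index)
  then have "mset (list_of_vec ?w) = image_mset (($) ?w) (mset_set {..<n})"
    by (simp add: atLeast0LessThan flip: mset_set_set)
  also have "{..<n} = set L \<union> ({..<n} - set L)"
    using L(1) by auto
  also have "mset_set (set L \<union> ({..<n} - set L)) = mset L + mset_set ({..<n} - set L)"
    using L by (subst mset_set_Union) (auto simp: mset_set_set)
  also have "image_mset (($) ?w) (mset L + mset_set ({..<n} - set L)) =
      mset (map (($) ?w) L) + image_mset (\<lambda>_. 0) (mset_set ({..<n} - set L))"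
    using u by (auto simp: row_list_selector_notin intro!: image_mset_cong)
  also have "map (($) ?w) L = list_of_vec u"
    using u list_selector_nth_less
    by (intro nth_equalityI) (auto simp: list_of_vec_index row_list_selector)
  also have "image_mset (\<lambda>_. 0) (mset_set ({..<n} - set L)) = replicate_mset (n - length L) (0 :: real)"
    using L by (simp add: image_mset_const_eq card_Diff_subset card)
  finally show ?thesis .
qed

lemma list_selector_compress_index:
  assumes N: "N \<in> carrier_mat n n" and kl: "k < length L" "l < length L"
  shows "((list_selector n L)\<^sup>T * N * list_selector n L) $$ (k, l) = N $$ (L ! k, L ! l)"
proof -
  let ?E = "list_selector n L"
  have "(?E\<^sup>T * N * ?E) $$ (k, l) = row (?E\<^sup>T * N) k \<bullet> unit_vec n (L ! l)"
    using N kl by (simp add: col_list_selector)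
  also have "\<dots> = (?E\<^sup>T * N) $$ (k, L ! l)"
    using N kl list_selector_nth_less[of l] by (subst scalar_prod_right_unit[of _ n]) simp_all
  also have "\<dots> = unit_vec n (L ! k) \<bullet> col N (L ! l)"
    using N kl list_selector_nth_less[of l] by (simp add: col_list_selector)
  also have "\<dots> = N $$ (L ! k, L ! l)"
    using N kl list_selector_nth_less by (subst scalar_prod_left_unit[of _ n]) (auto intro!: carrier_vecI)
  finally show ?thesis .
qed

lemma list_selector_expand_index:
  assumes T: "T \<in> carrier_mat (length L) (length L)" and kl: "k < length L" "l < length L"
  shows "(list_selector n L * T * (list_selector n L)\<^sup>T) $$ (L ! k, L ! l) = T $$ (k, l)"
proof -
  let ?E = "list_selector n L"
  note less = list_selector_nth_less[OF kl(1)] list_selector_nth_less[OF kl(2)]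
  have "(?E * T * ?E\<^sup>T) $$ (L ! k, L ! l) = row (?E * T) (L ! k) \<bullet> unit_vec (length L) l"
    using T less kl by (simp add: row_list_selector)
  also have "\<dots> = (?E * T) $$ (L ! k, l)"
    using T less kl by (subst scalar_prod_right_unit[of _ "length L"]) simp_all
  also have "\<dots> = unit_vec (length L) k \<bullet> col T l"
    using T less kl by (simp add: row_list_selector)
  also have "\<dots> = T $$ (k, l)"
    using T kl by (subst scalar_prod_left_unit[of _ "length L"]) simp_all
  finally show ?thesis .
qed

lemma list_selector_expand_index_zero:
  assumes T: "T \<in> carrier_mat (length L) (length L)" and ij: "i < n" "j < n"
    and notin: "i \<notin> set L \<or> j \<notin> set L"
  shows "(list_selector n L * T * (list_selector n L)\<^sup>T) $$ (i, j) = 0"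
proof -
  let ?E = "list_selector n L" and ?k = "length L"
  have eq: "(?E * T * ?E\<^sup>T) $$ (i, j) = row (?E * T) i \<bullet> row ?E j"
    using T ij by simp
  show ?thesis
  proof (cases "j \<in> set L")
    case True
    then have "row ?E i = 0\<^sub>v ?k"
      using notin ij by (simp add: row_list_selector_notin)
    then have "row (?E * T) i = 0\<^sub>v ?k"
      using T ij by (intro eq_vecI) (auto simp: scalar_prod_left_zero[of _ ?k])
    then show ?thesis
      using ij unfolding eq by (simp add: scalar_prod_left_zero[of _ ?k] carrier_vecI)
  next
    case False
    then show ?thesis
      using T ij unfolding eq by (simp add: row_list_selector_notin scalar_prod_right_zero[of _ ?k] carrier_vecI)
  qed
qed

lemma mat_supp_list_selector_expand:
  assumes "T \<in> carrier_mat (length L) (length L)"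
  shows "mat_supp (list_selector n L * T * (list_selector n L)\<^sup>T) \<subseteq> set L"
  unfolding mat_supp_def using list_selector_expand_index_zero[OF assms] by force

lemma list_selector_expand_compress:
  assumes S: "S \<in> sym_mats n" and supp: "mat_supp S \<subseteq> set L"
  shows "list_selector n L * ((list_selector n L)\<^sup>T * S * list_selector n L) * (list_selector n L)\<^sup>T = S"
    (is "?E * ?T * ?E\<^sup>T = S")
proof (rule eq_matI)
  note S' = sym_matsD[OF S]
  have T: "?T \<in> carrier_mat (length L) (length L)"
    using S' by (auto intro!: mult_carrier_mat)
  fix i j assume "i < dim_row S" "j < dim_col S"
  then have ij: "i < n" "j < n" using S' by auto
  show "(?E * ?T * ?E\<^sup>T) $$ (i, j) = S $$ (i, j)"
  proof (cases "i \<in> set L \<and> j \<in> set L")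
    case True
    then obtain k l where "k < length L" "l < length L" "i = L ! k" "j = L ! l"
      by (metis in_set_conv_nth)
    then show ?thesis
      using list_selector_expand_index[OF T] list_selector_compress_index[OF S'(1)] by simp
  next
    case False
    have "S $$ (i, j) = S $$ (j, i)"
      using S' ij by (metis carrier_matD index_transpose_mat(1))
    moreover have "S $$ (x, y) = 0" if "x < n" "y < n" "x \<notin> set L" for x y
      using that supp S' by (auto simp: mat_supp_def)
    ultimately have "S $$ (i, j) = 0"
      using False ij by metis
    then show ?thesis
      using list_selector_expand_index_zero[OF T ij] False by auto
  qed
qed (use sym_matsD[OF S] in auto)

end

text \<open>
  Completing \<open>L\<close> by the missing indices \<open>M\<close> gives an orthogonal \<open>W\<close> in whose basis the lifted matrix is
  block diagonal with blocks \<open>T\<close> and \<open>0\<close>.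
\<close>

lemma mset_eigvals_list_selector_expand:
  assumes L: "set L \<subseteq> {..<n}" "distinct L" and T: "T \<in> sym_mats (length L)"
  shows "mset (list_of_vec (eigvals (list_selector n L * T * (list_selector n L)\<^sup>T))) =
    mset (list_of_vec (eigvals T)) + replicate_mset (n - length L) 0"
proof -
  let ?E = "list_selector n L" and ?k = "length L" and ?m = "n - length L"
  let ?N = "?E * T * ?E\<^sup>T"
  note T' = sym_matsD[OF T]
  have N: "?N \<in> carrier_mat n n"
    using T' by (auto intro!: mult_carrier_mat)
  have card: "card (set L) = ?k"
    using L(2) distinct_card by blast
  then have k_le: "?k \<le> n"
    using card_mono[OF _ L(1)] by simp
  define M where "M = sorted_list_of_set ({..<n} - set L)"
  have M: "set (L @ M) \<subseteq> {..<n}" "distinct (L @ M)"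
    using L by (auto simp: M_def)
  have len: "length (L @ M) = n"
    using L card k_le by (simp add: M_def card_Diff_subset)
  define W where "W = list_selector n (L @ M)"
  have W: "W \<in> carrier_mat n n"
    using list_selector_carrier[of n "L @ M"] unfolding len W_def .
  have "W\<^sup>T * W = 1\<^sub>m n"
    using list_selector_isometry[OF M] unfolding len W_def .
  then have W_orth: "W \<in> orthogonal_mats n"
    using W mat_mult_left_right_inverse[of "W\<^sup>T" n W] by (simp add: orthogonal_mats_def)
  have block: "W\<^sup>T * ?N * W = four_block_mat T (0\<^sub>m ?k ?m) (0\<^sub>m ?m ?k) (0\<^sub>m ?m ?m)" (is "_ = ?B")
  proof (rule eq_matI)
    have dims: "dim_row ?B = n" "dim_col ?B = n"
      using T' k_le by auto
    then show "dim_row (W\<^sup>T * ?N * W) = dim_row ?B" "dim_col (W\<^sup>T * ?N * W) = dim_col ?B"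
      using W N by simp_all
    fix i j assume "i < dim_row ?B" "j < dim_col ?B"
    then have ij: "i < n" "j < n" by (simp_all only: dims)
    have lt: "(L @ M) ! i < n" "(L @ M) ! j < n"
      using list_selector_nth_less[OF M] ij len by simp_all
    have notin: "(L @ M) ! x \<notin> set L" if "x < n" "\<not> x < ?k" for x
    proof -
      have "(L @ M) ! x = M ! (x - ?k)"
        using that by (simp add: nth_append)
      moreover have "M ! (x - ?k) \<in> set M"
        using that len by (intro nth_mem) auto
      ultimately show ?thesis
        using M(2) by auto
    qed
    have "(W\<^sup>T * ?N * W) $$ (i, j) = ?N $$ ((L @ M) ! i, (L @ M) ! j)"
      unfolding W_def using ij len by (intro list_selector_compress_index[OF M N]) simp_all
    also have "\<dots> = (if i < ?k \<and> j < ?k then T $$ (i, j) else 0)"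
    proof (cases "i < ?k \<and> j < ?k")
      case True
      then show ?thesis
        using list_selector_expand_index[OF L T'(1), of i j] by (simp add: nth_append)
    next
      case False
      then show ?thesis
        using list_selector_expand_index_zero[OF L T'(1) lt] notin ij by auto
    qed
    also have "\<dots> = ?B $$ (i, j)"
      using ij T' k_le by auto
    finally show "(W\<^sup>T * ?N * W) $$ (i, j) = ?B $$ (i, j)" .
  qed
  have zero: "char_poly (0\<^sub>m ?m ?m :: real mat) = (\<Prod>a\<leftarrow>replicate ?m 0. [:- a, 1:])"
  proof -
    have "diag_mat (0\<^sub>m ?m ?m :: real mat) = replicate ?m 0"
      by (intro nth_equalityI) (auto simp: diag_mat_def)
    then show ?thesis
      using char_poly_upper_triangular[of "0\<^sub>m ?m ?m :: real mat" ?m] by simp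
  qed
  have "char_poly ?N = char_poly (W\<^sup>T * ?N * W\<^sup>T\<^sup>T)"
    using similar_orthogonal_conjugation[OF orthogonal_mats_transpose[OF W_orth] N]
    by (metis char_poly_similar)
  also have "\<dots> = char_poly ?B"
    by (simp add: block)
  also have "\<dots> = char_poly T * char_poly (0\<^sub>m ?m ?m)"
  proof (rule char_poly_0_block[OF refl])
    show "\<exists>es. char_poly T = (\<Prod>a\<leftarrow>es. [:- a, 1:])"
      using char_poly_sym_splits[OF T] by blast
    show "\<exists>es. char_poly (0\<^sub>m ?m ?m :: real mat) = (\<Prod>a\<leftarrow>es. [:- a, 1:])"
      using zero by blast
  qed (use T' in auto)
  also have "\<dots> = (\<Prod>a\<leftarrow>sorted_list_of_multiset (proots (char_poly T)) @ replicate ?m 0. [:- a, 1:])"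
    unfolding zero map_append prod_list.append by (rule arg_cong[OF char_poly_sym_splits[OF T]])
  finally have "proots (char_poly ?N) = mset (sorted_list_of_multiset (proots (char_poly T)) @ replicate ?m 0)"
    by (simp only: proots_linear_factors)
  then show ?thesis
    by (simp add: eigvals_def list_vec)
qed

section \<open>Minimising over the spectral ball of a symmetric gauge\<close>

context sym_gauge
begin

text \<open>
  The reversed spectrum of \<open>S\<close> in the trace inequality is a competitor in the dual norm.
\<close>

lemma frob_inner_ge_neg_dual_norm:
  assumes A: "A \<in> sym_mats m" and S: "S \<in> psd_mats m" "\<psi> (eigvals S) \<le> 1"
  shows "- dual_norm m \<psi> (eigvals_neg A) \<le> frob_inner S A"
proof -
  let ?r = "vec m (\<lambda>i. eigvals S $ (m - Suc i))"
  note s = eigvals_carrier[OF psd_matsD(1)[OF S(1)]]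
  have "list_of_vec ?r = rev (list_of_vec (eigvals S))"
    using s by (intro nth_equalityI) (auto simp: list_of_vec_index rev_nth)
  then have "\<psi> ?r = \<psi> (eigvals S)"
    using s by (intro gauge_cong_mset) auto
  then have "eigvals_neg A \<bullet> ?r \<le> dual_norm m \<psi> (eigvals_neg A)"
    using S(2) eigvals_carrier[OF A]
    by (intro scalar_prod_le_dual_norm) (auto simp: eigvals_neg_def)
  then show ?thesis
    using frob_inner_psd_lower_bound[OF S(1) A] by linarith
qed

lemma conjugated_diag_feasible:
  assumes Q: "Q \<in> orthogonal_mats m" and z: "z \<in> carrier_vec m" "\<And>i. i < m \<Longrightarrow> 0 \<le> z $ i" "\<psi> z \<le> 1"
  shows "Q * diag_of_vec z * Q\<^sup>T \<in> psd_mats m" "\<psi> (eigvals (Q * diag_of_vec z * Q\<^sup>T)) \<le> 1"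
proof -
  show psd: "Q * diag_of_vec z * Q\<^sup>T \<in> psd_mats m"
    using orthogonal_matsD(1)[OF Q] diag_of_vec_psd[OF z(1,2)] by (rule psd_mats_conjugation)
  have "\<psi> (eigvals (Q * diag_of_vec z * Q\<^sup>T)) = \<psi> z"
    using eigvals_carrier[OF psd_matsD(1)[OF psd]] z(1) mset_eigvals_conjugated_diag[OF Q z(1)]
    by (rule gauge_cong_mset)
  then show "\<psi> (eigvals (Q * diag_of_vec z * Q\<^sup>T)) \<le> 1"
    using z(3) by simp
qed

end

text \<open>
  On the support of \<open>\<lambda>\<^sub>-(A)\<close> the eigenvalues of \<open>A\<close> are exactly the entries of \<open>- \<lambda>\<^sub>-(A)\<close>.
\<close>

lemma frob_inner_conjugated_diag_neg_supp:
  assumes Q: "Q \<in> orthogonal_mats m" and A: "A \<in> sym_mats m"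
    and eq: "A = Q * diag_of_vec (eigvals A) * Q\<^sup>T"
    and z: "z \<in> carrier_vec m" "vec_supp z \<subseteq> vec_supp (eigvals_neg A)"
  shows "frob_inner (Q * diag_of_vec z * Q\<^sup>T) A = - (eigvals_neg A \<bullet> z)"
proof -
  note a = eigvals_carrier[OF A]
  have "diag_of_vec (eigvals A) \<in> carrier_mat m m"
    using a diag_of_vec_carrier[of "eigvals A"] by simp
  then have "Q\<^sup>T * A * Q = diag_of_vec (eigvals A)"
    using orthogonal_conjugation_inverse[OF Q] eq by metis
  then have "frob_inner (Q * diag_of_vec z * Q\<^sup>T) A = (\<Sum>i<m. z $ i * eigvals A $ i)"
    using frob_inner_conjugated_diag[OF orthogonal_matsD(1)[OF Q] z(1) sym_matsD(1)[OF A]] a by simp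
  also have "\<dots> = (\<Sum>i<m. - (eigvals_neg A $ i * z $ i))"
  proof (rule sum.cong)
    fix i assume "i \<in> {..<m}"
    then have i: "i < m" by simp
    show "z $ i * eigvals A $ i = - (eigvals_neg A $ i * z $ i)"
    proof (cases "z $ i = 0")
      case False
      then have "eigvals_neg A $ i \<noteq> 0"
        using z i by (auto simp: vec_supp_def)
      then show ?thesis
        using i a by (simp add: eigvals_neg_def max_def split: if_splits)
    qed simp
  qed simp
  also have "\<dots> = - (eigvals_neg A \<bullet> z)"
    using z(1) by (simp add: scalar_prod_def atLeast0LessThan sum_negf)
  finally show ?thesis .
qed

section \<open>Principal blocks and padded gauges\<close>

lemma mset_permutation_mult_vec:
  assumes P: "P \<in> permutation_mats m" and z: "z \<in> carrier_vec m"
  shows "mset (list_of_vec (P *\<^sub>v z)) = mset (list_of_vec z)"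
proof -
  obtain p where p: "p permutes {..<m}" and P_eq: "P = mat m m (\<lambda>(i, j). if j = p i then 1 else 0)"
    using P by (auto simp: permutation_mats_def)
  have "list_of_vec (P *\<^sub>v z) = permute_list p (list_of_vec z)"
  proof (rule nth_equalityI)
    fix i assume "i < length (list_of_vec (P *\<^sub>v z))"
    then have i: "i < m" by (simp add: P_eq)
    have pi: "p i < m"
      using permutes_in_image[OF p, of i] i by simp
    have "row P i = unit_vec m (p i)"
      using i pi by (intro eq_vecI) (auto simp: P_eq)
    then show "list_of_vec (P *\<^sub>v z) ! i = permute_list p (list_of_vec z) ! i"
      using i pi z p by (simp add: list_of_vec_index permute_list_nth) (simp add: P_eq)
  qed (use z in \<open>simp add: P_eq\<close>)
  then show ?thesis
    using p z by simp
qed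

context
  fixes n :: nat and I :: "nat set"
  assumes I: "I \<subseteq> {..<n}"
begin

lemma selector_list: "finite I" "selector n I = list_selector n (sorted_list_of_set I)"
    "set (sorted_list_of_set I) = I" "length (sorted_list_of_set I) = card I"
  using I finite_subset[OF I] by (auto simp: selector_eq_list_selector)

lemma selector_carrier: "selector n I \<in> carrier_mat n (card I)"
  by (simp add: selector_def)

lemma principal_block_sym: "X \<in> sym_mats n \<Longrightarrow> principal_block n I X \<in> sym_mats (card I)"
  using sym_mats_conjugation[of "(selector n I)\<^sup>T" "card I" n X] selector_carrier
  by (simp add: principal_block_def)

lemma principal_block_psd: "X \<in> psd_mats n \<Longrightarrow> principal_block n I X \<in> psd_mats (card I)"
  using psd_mats_conjugation[of "(selector n I)\<^sup>T" "card I" n X] selector_carrier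
  by (simp add: principal_block_def)

lemma lift_block_psd: "T \<in> psd_mats (card I) \<Longrightarrow> lift_block n I T \<in> psd_mats n"
  using psd_mats_conjugation[OF selector_carrier] by (simp add: lift_block_def)

lemma frob_inner_lift_block:
  "T \<in> carrier_mat (card I) (card I) \<Longrightarrow> X \<in> carrier_mat n n \<Longrightarrow>
    frob_inner (lift_block n I T) X = frob_inner T (principal_block n I X)"
  using frob_inner_conjugation[OF selector_carrier] by (simp add: lift_block_def principal_block_def)

lemma mset_eigvals_lift_block:
  assumes "T \<in> sym_mats (card I)"
  shows "mset (list_of_vec (eigvals (lift_block n I T))) =
    mset (list_of_vec (selector n I *\<^sub>v eigvals T))"
  using mset_eigvals_list_selector_expand[of "sorted_list_of_set I" n T]
    mset_list_selector_mult_vec[of "sorted_list_of_set I" n "eigvals T"]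
    selector_list I assms eigvals_carrier[OF assms]
  by (simp add: lift_block_def)

lemma eigvals_lift_block_gauge:
  assumes \<phi>: "symmetric_gauge n \<phi>" and T: "T \<in> psd_mats (card I)"
  shows "\<phi> (eigvals (lift_block n I T)) = padded_gauge n I \<phi> (eigvals T)"
proof -
  interpret sym_gauge n \<phi> using \<phi> by unfold_locales
  note T' = psd_matsD[OF T]
  show ?thesis
    unfolding padded_gauge_def
    using eigvals_carrier[OF psd_matsD(1)[OF lift_block_psd[OF T]]] selector_carrier
      eigvals_carrier[OF T'(1)] mset_eigvals_lift_block[OF T'(1)]
    by (intro gauge_cong_mset) auto
qed

text \<open>
  The norm axioms pull back along the injective linear map \<open>E\<close>. A permutation of \<open>u\<close> is a
  permutation of the padded vector because both have the same multiset of entries.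
\<close>

lemma padded_gauge_symmetric:
  assumes \<phi>: "symmetric_gauge n \<phi>"
  shows "symmetric_gauge (card I) (padded_gauge n I \<phi>)"
proof -
  interpret sym_gauge n \<phi> using \<phi> by unfold_locales
  let ?E = "selector n I" and ?L = "sorted_list_of_set I"
  note E = selector_carrier
  have EE: "?E\<^sup>T * ?E = 1\<^sub>m (card I)"
    using list_selector_isometry[of ?L n] selector_list I by simp
  have inj: "?E *\<^sub>v z = 0\<^sub>v n \<longleftrightarrow> z = 0\<^sub>v (card I)" if z: "z \<in> carrier_vec (card I)" for z
  proof
    assume 0: "?E *\<^sub>v z = 0\<^sub>v n"
    have "z = (?E\<^sup>T * ?E) *\<^sub>v z" using z by (simp add: EE)
    also have "\<dots> = ?E\<^sup>T *\<^sub>v (?E *\<^sub>v z)"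
      using E z by (intro assoc_mult_mat_vec) auto
    also have "\<dots> = 0\<^sub>v (card I)"
      unfolding 0 using E by (intro eq_vecI) auto
    finally show "z = 0\<^sub>v (card I)" .
  next
    assume "z = 0\<^sub>v (card I)"
    then show "?E *\<^sub>v z = 0\<^sub>v n"
      using E by (intro eq_vecI) auto
  qed
  have abs: "\<phi> (?E *\<^sub>v map_vec abs z) = \<phi> (?E *\<^sub>v z)" if z: "z \<in> carrier_vec (card I)" for z
  proof (rule gauge_cong_abs)
    fix i assume i: "i < n"
    show "\<bar>(?E *\<^sub>v map_vec abs z) $ i\<bar> = \<bar>(?E *\<^sub>v z) $ i\<bar>"
    proof (cases "i \<in> I")
      case True
      then obtain k where k: "k < card I" "i = ?L ! k"
        using selector_list by (metis in_set_conv_nth)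
      then have "row ?E i = unit_vec (card I) k"
        using row_list_selector[of ?L n k] selector_list I by simp
      then show ?thesis
        using i k(1) z E by simp
    next
      case False
      then have "row ?E i = 0\<^sub>v (card I)"
        using row_list_selector_notin[of ?L n i] selector_list I i by simp
      then show ?thesis
        using i z E by simp
    qed
  qed (use z E in auto)
  have perm: "\<phi> (?E *\<^sub>v (P *\<^sub>v z)) = \<phi> (?E *\<^sub>v z)"
    if "P \<in> permutation_mats (card I)" and z: "z \<in> carrier_vec (card I)" for P z
  proof -
    have Pz: "P *\<^sub>v z \<in> carrier_vec (card I)"
      using that by (intro carrier_vecI) (auto simp: permutation_mats_def)
    show ?thesis
      using mset_permutation_mult_vec[OF that] z Pz E selector_list I
        mset_list_selector_mult_vec[of ?L n]
      by (intro gauge_cong_mset) auto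
  qed
  show ?thesis
    unfolding symmetric_gauge_def norm_on_def padded_gauge_def
    using E gauge_nonneg gauge_zero_iff inj abs perm
    by (auto simp: mult_mat_vec[of ?E n "card I"] gauge_smult mult_add_distrib_mat_vec[of ?E n "card I"]
        intro!: gauge_triangle)
qed

text \<open>
  This is the reduction of the \<open>n\<close>-dimensional problem to the principal block.
\<close>

lemma sep_feasible_eq_lifted_ball:
  assumes \<phi>: "symmetric_gauge n \<phi>"
  shows "sep_feasible n I \<phi> = lifted_ball n I \<phi>"
proof (intro equalityI subsetI)
  let ?L = "sorted_list_of_set I"
  have L: "set ?L \<subseteq> {..<n}" "distinct ?L" using selector_list I by auto
  {
    fix S assume "S \<in> sep_feasible n I \<phi>"
    then have S: "S \<in> psd_mats n" "\<phi> (eigvals S) \<le> 1" "mat_supp S \<subseteq> I"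
      by (auto simp: sep_feasible_def spectral_ball_def)
    have eq: "lift_block n I (principal_block n I S) = S"
      using list_selector_expand_compress[OF L psd_matsD(1)[OF S(1)]] S(3) selector_list
      by (simp add: lift_block_def principal_block_def)
    then show "S \<in> lifted_ball n I \<phi>"
      unfolding lifted_ball_def
      using S(2) principal_block_psd[OF S(1)] eigvals_lift_block_gauge[OF \<phi> principal_block_psd[OF S(1)]]
      by (intro image_eqI[of _ _ "principal_block n I S"]) auto
  next
    fix S assume "S \<in> lifted_ball n I \<phi>"
    then obtain T where T: "T \<in> psd_mats (card I)" "padded_gauge n I \<phi> (eigvals T) \<le> 1"
      and S: "S = lift_block n I T"
      by (auto simp: lifted_ball_def)
    have "mat_supp S \<subseteq> I"
      using mat_supp_list_selector_expand[OF L, of T] psd_matsD(2)[OF T(1)] selector_list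
      by (simp add: S lift_block_def)
    then show "S \<in> sep_feasible n I \<phi>"
      using T psd_matsD(1)[OF lift_block_psd[OF T(1)]] lift_block_psd[OF T(1)]
        eigvals_lift_block_gauge[OF \<phi> T(1)]
      by (simp add: sep_feasible_def spectral_ball_def S)
  }
qed

end

section \<open>The optimal separator\<close>

lemma minimum_eqI:
  assumes "x \<in> A" "\<And>y. y \<in> A \<Longrightarrow> f x \<le> f y"
  shows "minimum f A = f x"
  unfolding minimum_def using assms by (intro Least_equality) auto

theorem proposition4p6:
  fixes n :: nat and I :: "nat set" and \<phi> :: "real vec \<Rightarrow> real" and X :: "real mat"
  assumes "symmetric_gauge n \<phi>"
    and "I \<subseteq> {..<n}"
    and "X \<in> sym_mats n"
  shows
    "(\<exists>S. is_arg_min (\<lambda>S. frob_inner S X) (\<lambda>S. S \<in> sep_feasible n I \<phi>) S) \<and>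
     (\<exists>S. is_arg_min (\<lambda>S. frob_inner S (principal_block n I X)) 
        (\<lambda>S. S \<in> psd_mats (card I) \<and> padded_gauge n I \<phi> (eigvals S) \<le> 1) S) \<and>
     (\<exists>z. is_arg_max (\<lambda>z. \<bar>eigvals_neg (principal_block n I X) \<bullet> z\<bar>)
        (\<lambda>z. z \<in> carrier_vec (card I) \<and> padded_gauge n I \<phi> z \<le> 1) z) \<and>
     sep_value n I \<phi> X =
       minimum (\<lambda>S. frob_inner S (principal_block n I X))
         {S \<in> psd_mats (card I). padded_gauge n I \<phi> (eigvals S) \<le> 1} \<and>
     minimum (\<lambda>S. frob_inner S (principal_block n I X))
         {S \<in> psd_mats (card I). padded_gauge n I \<phi> (eigvals S) \<le> 1} =
       - dual_norm (card I) (padded_gauge n I \<phi>) (eigvals_neg (principal_block n I X)) \<and>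
     (sep_value n I \<phi> X = 0 \<longleftrightarrow> X \<in> dual_cone n (lift_block n I ` psd_mats (card I))) \<and>
     lifted_ball n I \<phi> \<subseteq> lift_block n I ` psd_mats (card I) \<and>
     (\<forall>Q z S.
        sep_value n I \<phi> X < 0 \<longrightarrow>
        Q \<in> orthogonal_mats (card I) \<longrightarrow>
        principal_block n I X =
          Q * diag_of_vec (eigvals (principal_block n I X)) * transpose_mat Q \<longrightarrow>
        is_arg_max (\<lambda>z. eigvals_neg (principal_block n I X) \<bullet> z)
          (\<lambda>z. z \<in> carrier_vec (card I) \<and> (\<forall>i<card I. 0 \<le> z $ i) \<and>
            padded_gauge n I \<phi> z \<le> 1 \<and>
            vec_supp z \<subseteq> vec_supp (eigvals_neg (principal_block n I X))) z \<longrightarrow>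
        S = selector n I * Q * diag_of_vec z * transpose_mat Q * transpose_mat (selector n I) \<longrightarrow>
        is_arg_min (\<lambda>S. frob_inner S X) (\<lambda>S. S \<in> sep_feasible n I \<phi>) S \<and>
        S \<in> lifted_ball n I \<phi> \<and>
        (\<forall>Y \<in> dual_cone n (lift_block n I ` psd_mats (card I)). 0 \<le> frob_inner S Y) \<and>
        (\<forall>Y \<in> psd_mats n. 0 \<le> frob_inner S Y))"
proof -
  note \<phi> = assms(1) and I = assms(2)
  define k A \<psi> b where "k = card I" and "A = principal_block n I X"
    and "\<psi> = padded_gauge n I \<phi>" and "b = eigvals_neg A"
  define F where "F = {S \<in> psd_mats k. \<psi> (eigvals S) \<le> 1}"
  interpret sym_gauge k \<psi>
    using padded_gauge_symmetric[OF I \<phi>] by unfold_locales (simp add: k_def \<psi>_def)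
  note X = sym_matsD[OF assms(3)]
  have A: "A \<in> sym_mats k"
    using principal_block_sym[OF I assms(3)] by (simp add: A_def k_def)
  note a = eigvals_carrier[OF A]
  have b: "b \<in> carrier_vec k" and b_nonneg: "\<And>i. i < k \<Longrightarrow> 0 \<le> b $ i"
    using a by (auto simp: b_def eigvals_neg_def)
  have feasible: "sep_feasible n I \<phi> = lift_block n I ` F"
    using sep_feasible_eq_lifted_ball[OF I \<phi>] by (simp add: lifted_ball_def F_def k_def \<psi>_def)
  have frob_lift: "frob_inner (lift_block n I T) Y = frob_inner T (principal_block n I Y)"
    if "T \<in> psd_mats k" "Y \<in> carrier_mat n n" for T Y
    using frob_inner_lift_block[OF I _ that(2)] psd_matsD(2)[OF that(1)] by (simp add: k_def)
  have lower: "- dual_norm k \<psi> b \<le> frob_inner T A" if "T \<in> F" for T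
    using frob_inner_ge_neg_dual_norm[OF A] that by (simp add: F_def b_def)
  have optimal: "Q * diag_of_vec z * Q\<^sup>T \<in> F \<and> frob_inner (Q * diag_of_vec z * Q\<^sup>T) A = - dual_norm k \<psi> b"
    if "Q \<in> orthogonal_mats k" "A = Q * diag_of_vec (eigvals A) * Q\<^sup>T" "z \<in> carrier_vec k"
      "\<And>i. i < k \<Longrightarrow> 0 \<le> z $ i" "\<psi> z \<le> 1" "vec_supp z \<subseteq> vec_supp b" "dual_norm k \<psi> b = b \<bullet> z" for Q z
    using conjugated_diag_feasible[OF that(1,3,4,5)] that(7)
      frob_inner_conjugated_diag_neg_supp[OF that(1) A that(2,3)] that(6)
    by (simp add: F_def b_def)
  obtain z0 where z0: "z0 \<in> carrier_vec k" "\<And>i. i < k \<Longrightarrow> 0 \<le> z0 $ i" "\<psi> z0 \<le> 1"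
    "vec_supp z0 \<subseteq> vec_supp b" "dual_norm k \<psi> b = b \<bullet> z0"
    using dual_norm_attained_nonneg[OF b b_nonneg] by blast
  obtain T0 where T0: "T0 \<in> F" "frob_inner T0 A = - dual_norm k \<psi> b"
    using spectral_theorem[OF A] optimal z0 by metis
  have arg_min_lift: "is_arg_min (\<lambda>S. frob_inner S X) (\<lambda>S. S \<in> sep_feasible n I \<phi>) (lift_block n I T)"
    if "T \<in> F" "frob_inner T A = - dual_norm k \<psi> b" for T
    using that lower frob_lift[OF _ X(1)]
    by (auto simp: is_arg_min_def feasible not_less A_def[symmetric] F_def)
  have min_F: "minimum (\<lambda>S. frob_inner S A) F = - dual_norm k \<psi> b"
    using minimum_eqI[of T0 F "\<lambda>S. frob_inner S A"] T0 lower by simp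
  have sep: "sep_value n I \<phi> X = minimum (\<lambda>S. frob_inner S A) F"
  proof -
    have "(\<lambda>S. frob_inner S X) ` lift_block n I ` F = (\<lambda>S. frob_inner S A) ` F"
      unfolding image_image A_def by (intro image_cong refl frob_lift X) (simp add: F_def)
    then show ?thesis
      by (simp add: sep_value_def minimum_def feasible)
  qed
  have dual_iff: "X \<in> dual_cone n (lift_block n I ` psd_mats k) \<longleftrightarrow> (\<forall>T \<in> psd_mats k. 0 \<le> frob_inner T A)"
    using assms(3) frob_lift[OF _ X(1)] by (auto simp: dual_cone_def A_def)
  have zero_iff: "sep_value n I \<phi> X = 0 \<longleftrightarrow> X \<in> dual_cone n (lift_block n I ` psd_mats k)"
  proof
    assume "sep_value n I \<phi> X = 0"
    then have "b = 0\<^sub>v k"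
      using dual_norm_eq_0_iff[OF b] sep min_F by simp
    then have "0 \<le> eigvals A $ i" if "i < k" for i
    proof -
      have "b $ i = 0" using that \<open>b = 0\<^sub>v k\<close> by simp
      then show ?thesis using that a by (simp add: b_def eigvals_neg_def max_def split: if_splits)
    qed
    then have "diag_of_vec (eigvals A) \<in> psd_mats k"
      using a by (intro diag_of_vec_psd) auto
    then have "A \<in> psd_mats k"
      using spectral_theorem[OF A] psd_mats_conjugation orthogonal_matsD(1) by metis
    then show "X \<in> dual_cone n (lift_block n I ` psd_mats k)"
      unfolding dual_iff using frob_inner_psd_nonneg by blast
  next
    assume "X \<in> dual_cone n (lift_block n I ` psd_mats k)"
    then have "0 \<le> frob_inner T0 A"
      using T0(1) by (simp add: dual_iff F_def)
    moreover have "0 \<le> dual_norm k \<psi> b"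
      using scalar_prod_le_dual_norm[OF b, of "0\<^sub>v k"] gauge_zero_iff[of "0\<^sub>v k"] b by simp
    ultimately show "sep_value n I \<phi> X = 0"
      using T0(2) sep min_F by simp
  qed
  have lifted_sub: "lifted_ball n I \<phi> \<subseteq> lift_block n I ` psd_mats k"
    by (auto simp: lifted_ball_def k_def)
  have arg_max: "\<exists>z. is_arg_max (\<lambda>z. \<bar>b \<bullet> z\<bar>) (\<lambda>z. z \<in> carrier_vec k \<and> \<psi> z \<le> 1) z"
  proof -
    obtain z where "z \<in> carrier_vec k" "\<psi> z \<le> 1"
      "\<And>y. y \<in> carrier_vec k \<Longrightarrow> \<psi> y \<le> 1 \<Longrightarrow> \<bar>b \<bullet> y\<bar> \<le> b \<bullet> z"
      using dual_norm_attained[OF b] by blast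
    then have "is_arg_max (\<lambda>z. \<bar>b \<bullet> z\<bar>) (\<lambda>z. z \<in> carrier_vec k \<and> \<psi> z \<le> 1) z"
      by (force simp: is_arg_max_def not_less)
    then show ?thesis by blast
  qed
  have separator: "is_arg_min (\<lambda>S. frob_inner S X) (\<lambda>S. S \<in> sep_feasible n I \<phi>) S \<and>
      S \<in> lifted_ball n I \<phi> \<and>
      (\<forall>Y \<in> dual_cone n (lift_block n I ` psd_mats k). 0 \<le> frob_inner S Y) \<and>
      (\<forall>Y \<in> psd_mats n. 0 \<le> frob_inner S Y)"
    if Q: "Q \<in> orthogonal_mats k" and A_eq: "A = Q * diag_of_vec (eigvals A) * Q\<^sup>T"
      and max: "is_arg_max (\<lambda>z. b \<bullet> z) (\<lambda>z. z \<in> carrier_vec k \<and> (\<forall>i<k. 0 \<le> z $ i) \<and> \<psi> z \<le> 1 \<and>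
            vec_supp z \<subseteq> vec_supp b) z"
      and S: "S = selector n I * Q * diag_of_vec z * Q\<^sup>T * (selector n I)\<^sup>T" for Q z S
  proof -
    have z: "z \<in> carrier_vec k" "\<And>i. i < k \<Longrightarrow> 0 \<le> z $ i" "\<psi> z \<le> 1" "vec_supp z \<subseteq> vec_supp b"
      using max by (auto simp: is_arg_max_def)
    \<comment> \<open>\<open>z0\<close> satisfies the extra constraints, so the restricted maximum equals the dual norm.\<close>
    have "b \<bullet> z0 \<le> b \<bullet> z"
      using max z0 by (auto simp: is_arg_max_def not_less)
    then have "dual_norm k \<psi> b = b \<bullet> z"
      using scalar_prod_le_dual_norm[OF b z(1,3)] z0(5) by simp
    then have T: "Q * diag_of_vec z * Q\<^sup>T \<in> F" "frob_inner (Q * diag_of_vec z * Q\<^sup>T) A = - dual_norm k \<psi> b"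
      using optimal[OF Q A_eq z] by auto
    have "diag_of_vec z \<in> carrier_mat k k"
      using z(1) diag_of_vec_carrier[of z] by simp
    then have S_lift: "S = lift_block n I (Q * diag_of_vec z * Q\<^sup>T)"
      unfolding S lift_block_def
      using selector_carrier[OF I] orthogonal_matsD(1)[OF Q]
      by (simp add: k_def assoc_mult_mat[of "selector n I" n "card I" _ "card I" _ "card I"]
          assoc_mult_mat[of Q "card I" "card I" _ "card I" _ "card I"])
    have psd: "Q * diag_of_vec z * Q\<^sup>T \<in> psd_mats k" using T(1) by (simp add: F_def)
    have "is_arg_min (\<lambda>S. frob_inner S X) (\<lambda>S. S \<in> sep_feasible n I \<phi>) S"
      unfolding S_lift using T by (rule arg_min_lift)
    moreover have "S \<in> lifted_ball n I \<phi>"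
      using T(1) feasible sep_feasible_eq_lifted_ball[OF I \<phi>] S_lift by blast
    moreover have "0 \<le> frob_inner S Y" if "Y \<in> dual_cone n (lift_block n I ` psd_mats k)" for Y
      using that psd S_lift by (auto simp: dual_cone_def)
    moreover have "0 \<le> frob_inner S Y" if Y: "Y \<in> psd_mats n" for Y
      unfolding S_lift using frob_lift[OF psd psd_matsD(2)[OF Y]] psd principal_block_psd[OF I Y]
      by (simp add: frob_inner_psd_nonneg k_def)
    ultimately show ?thesis by blast
  qed
  have arg_min_F: "is_arg_min (\<lambda>S. frob_inner S A) (\<lambda>S. S \<in> psd_mats k \<and> \<psi> (eigvals S) \<le> 1) T0"
    using T0 lower by (auto simp: is_arg_min_def not_less F_def)
  show ?thesis
    unfolding k_def[symmetric] A_def[symmetric] \<psi>_def[symmetric] b_def[symmetric] F_def[symmetric]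
    using arg_min_lift[OF T0] arg_min_F arg_max sep min_F zero_iff lifted_sub separator
    by blast
qed

end
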